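(* Let $U$ be a unitary operator on $\mathbb{C}^N$ with $N$ distinct eigenvalues $\lambda_1,\dots,\lambda_N$ and corresponding orthonormal eigenvectors $\psi_1,\dots,\psi_N$, and let $k\ge 1$ be an integer with $N\ge 3k$. Then $\Delta_k(U)=\Lambda_k(U)=\Omega_k(U)$ and this set is nonempty. Moreover, for every $\lambda\in\Omega_k(U)$ there are indices $a_j,b_j,c_j\in\{1,\dots,N\}$, $j=1,\dots,k$, all $3k$ of them distinct, such that $\lambda\in\operatorname{conv}\{\lambda_{a_j},\lambda_{b_j},\lambda_{c_j}\}$ for each $j$. Given such indices and numbers $t_{1j},t_{2j},t_{3j}\ge 0$ with $t_{1j}+t_{2j}+t_{3j}=1$ and $\lambda=t_{1j}\lambda_{a_j}+t_{2j}\lambda_{b_j}+t_{3j}\lambda_{c_j}$ for $j=1,\dots,k$, the vectors $$\phi_j=\sqrt{t_{1j}}\,\psi_{a_j}+\sqrt{t_{2j}}\,\psi_{b_j}+\sqrt{t_{3j}}\,\psi_{c_j}\qquad (j=1,\dots,k)$$ are orthonormal, and the $k$-dimensional subspace $\operatorname{span}\{\phi_1,\dots,\phi_k\}$ is correctable for every channel of the form $\mathcal{E}(\rho)=p\,\rho+(1-p)\,U\rho U^\dagger$ with $0<p<1$.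
   Context: Let $T$ be an operator on $\mathbb{C}^N$ with eigenvalues $\lambda_1,\dots,\lambda_N$ (listed with multiplicity), and let $1\le k\le N$. $\Lambda_k(T)$ is the set of $\lambda\in\mathbb{C}$ such that $PTP=\lambda P$ for some orthogonal projection $P$ of rank $k$. $\Omega_k(T)=\bigcap_{S}\operatorname{conv}\{\lambda_j: j\in S\}$, where $S$ runs over all subsets of $\{1,\dots,N\}$ with exactly $N-k+1$ elements. For unitary $U$, $\Delta_k(U)$ is the set of $\lambda\in\mathbb{C}$ for which there exist $k$ pairwise disjoint subsets $S_1,\dots,S_k$ of $\{1,\dots,N\}$ with $\lambda\in\operatorname{conv}\{\lambda_j:j\in S_i\}$ for each $i$. A quantum operation (channel) on $\mathcal{H}=\mathbb{C}^N$ is a completely positive trace-preserving linear map $\mathcal{E}:\mathcal{L}(\mathcal{H})\to\mathcal{L}(\mathcal{H})$. A subspace $\mathcal{C}\subseteq\mathcal{H}$ with orthogonal projection $P_{\mathcal{C}}$ is correctable for $\mathcal{E}$ if there is a quantum operation $\mathcal{R}$ on $\mathcal{H}$ with $(\mathcal{R}\circ\mathcal{E})(\rho)=\rho$ for all $\rho\in P_{\mathcal{C}}\mathcal{L}(\mathcal{H})P_{\mathcal{C}}$. *)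

theory Defs
  imports
    "HOL-Analysis.Analysis"
    "HOL-Combinatorics.Permutations"
    "HOL-Computational_Algebra.Fundamental_Theorem_Algebra"
begin

text \<open>
  Operators on \<open>\<complex>\<^sup>N\<close> are matrices of type \<open>complex ^ 'n ^ 'n\<close> with \<open>N = CARD('n)\<close>; the index
  type \<open>'n\<close> plays the role of \<open>{1, \<dots>, N}\<close>. The library's \<open>inner\<close> on \<open>complex ^ 'n\<close> is
  the underlying real inner product and its \<open>rank\<close> and \<open>vec.span\<close> are taken over the complex field.
\<close>

definition cinner :: "complex ^ 'n \<Rightarrow> complex ^ 'n \<Rightarrow> complex" where
  "cinner x y = (\<Sum>i\<in>UNIV. cnj (x $ i) * y $ i)"

definition adj :: "complex ^ 'n ^ 'm \<Rightarrow> complex ^ 'm ^ 'n" where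
  "adj A = (\<chi> i j. cnj (A $ j $ i))"

definition cscale :: "complex \<Rightarrow> complex ^ 'n ^ 'm \<Rightarrow> complex ^ 'n ^ 'm" where
  "cscale c A = (\<chi> i j. c * A $ i $ j)"

definition unitary :: "complex ^ 'n ^ 'n \<Rightarrow> bool" where
  "unitary U \<longleftrightarrow> adj U ** U = mat 1 \<and> U ** adj U = mat 1"

definition orth_proj :: "complex ^ 'n ^ 'n \<Rightarrow> bool" where
  "orth_proj P \<longleftrightarrow> adj P = P \<and> P ** P = P"

definition orthonormal_on :: "'i set \<Rightarrow> ('i \<Rightarrow> complex ^ 'n) \<Rightarrow> bool" where
  "orthonormal_on I v \<longleftrightarrow> (\<forall>i\<in>I. \<forall>j\<in>I. cinner (v i) (v j) = (if i = j then 1 else 0))"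


definition eigenvalue_listing :: "complex ^ 'n ^ 'n \<Rightarrow> ('n \<Rightarrow> complex) \<Rightarrow> bool" where
  "eigenvalue_listing T l \<longleftrightarrow> (\<forall>z. det (mat z - T) = (\<Prod>i\<in>UNIV. z - l i))"

text \<open>
  The eigenvalues listed with algebraic multiplicity, in some order. A listing exists and is unique
  up to a permutation of the indices (\<open>eigenvalue_listing_exists\<close>,
  \<open>eigenvalue_listing_unique\<close>), so the sets defined from it do not depend on the choice
  (\<open>Omega_eq\<close>, \<open>Delta_eq\<close>).
\<close>

definition eigenvalues :: "complex ^ 'n ^ 'n \<Rightarrow> 'n \<Rightarrow> complex" where
  "eigenvalues T = (SOME l. eigenvalue_listing T l)"

definition Lambda :: "nat \<Rightarrow> complex ^ 'n ^ 'n \<Rightarrow> complex set" where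
  "Lambda k T = {z. \<exists>P. orth_proj P \<and> rank P = k \<and> P ** T ** P = cscale z P}"

definition Omega :: "nat \<Rightarrow> complex ^ 'n ^ 'n \<Rightarrow> complex set" where
  "Omega k (T :: complex ^ 'n ^ 'n) =
     (\<Inter>S\<in>{S :: 'n set. card S = CARD('n) - k + 1}. convex hull (eigenvalues T ` S))"

definition Delta :: "nat \<Rightarrow> complex ^ 'n ^ 'n \<Rightarrow> complex set" where
  "Delta k (T :: complex ^ 'n ^ 'n) =
     {z. \<exists>S :: nat \<Rightarrow> 'n set. disjoint_family_on S {1..k} \<and>
           (\<forall>i\<in>{1..k}. z \<in> convex hull (eigenvalues T ` S i))}"


text \<open>
  A family \<open>X i j\<close> (\<open>i, j < m\<close>) of operators is the block matrix
  \<open>\<Sum> E\<^sub>i\<^sub>j \<otimes> X i j\<close>, an operator on \<open>\<complex>\<^sup>m \<otimes> \<complex>\<^sup>N\<close>; on it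
  \<open>id \<otimes> \<E>\<close> acts blockwise.
\<close>

definition block_positive :: "nat \<Rightarrow> (nat \<Rightarrow> nat \<Rightarrow> complex ^ 'n ^ 'n) \<Rightarrow> bool" where
  "block_positive m X \<longleftrightarrow>
     (\<forall>v. (\<Sum>i<m. \<Sum>j<m. cinner (v i) (X i j *v v j)) \<in> \<real>\<^sub>\<ge>\<^sub>0)"

definition completely_positive :: "(complex ^ 'n ^ 'n \<Rightarrow> complex ^ 'n ^ 'n) \<Rightarrow> bool" where
  "completely_positive \<E> \<longleftrightarrow>
     (\<forall>m X. block_positive m X \<longrightarrow> block_positive m (\<lambda>i j. \<E> (X i j)))"

definition quantum_operation :: "(complex ^ 'n ^ 'n \<Rightarrow> complex ^ 'n ^ 'n) \<Rightarrow> bool" where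
  "quantum_operation \<E> \<longleftrightarrow>
     (\<forall>A B. \<E> (A + B) = \<E> A + \<E> B) \<and> (\<forall>c A. \<E> (cscale c A) = cscale c (\<E> A)) \<and>
     completely_positive \<E> \<and> (\<forall>A. trace (\<E> A) = trace A)"

text \<open>The orthogonal projection \<open>P\<close> with range \<open>C\<close> is unique (\<open>orth_proj_unique\<close>).\<close>

definition correctable :: "(complex ^ 'n ^ 'n \<Rightarrow> complex ^ 'n ^ 'n) \<Rightarrow> (complex ^ 'n) set \<Rightarrow> bool" where
  "correctable \<E> C \<longleftrightarrow>
     (\<exists>P. orth_proj P \<and> range ((*v) P) = C \<and>
       (\<exists>\<R>. quantum_operation \<R> \<and> (\<forall>\<rho>\<in>{P ** A ** P | A. True}. (\<R> \<circ> \<E>) \<rho> = \<rho>)))"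


lemma cinner_adj: "cinner x (A *v y) = cinner (adj A *v x) y"
proof -
  have "cinner x (A *v y) = (\<Sum>i\<in>UNIV. \<Sum>j\<in>UNIV. cnj (x $ i) * (A $ i $ j * y $ j))"
    by (simp add: cinner_def matrix_vector_mult_def sum_distrib_left)
  also have "\<dots> = (\<Sum>j\<in>UNIV. \<Sum>i\<in>UNIV. cnj (x $ i) * (A $ i $ j * y $ j))"
    by (rule sum.swap)
  also have "\<dots> = cinner (adj A *v x) y"
    by (simp add: cinner_def matrix_vector_mult_def adj_def sum_distrib_left sum_distrib_right mult_ac)
  finally show ?thesis .
qed

lemma orth_proj_unique:
  assumes "orth_proj P" "orth_proj Q" "range ((*v) P) = range ((*v) Q)"
  shows "P = Q"
proof -
  have absorb: "A ** B = B" if "orth_proj A" "range ((*v) B) \<subseteq> range ((*v) A)"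
    for A B :: "complex ^ 'n ^ 'n"
  proof -
    have "A *v (B *v x) = B *v x" for x
    proof -
      obtain y where "B *v x = A *v y" using \<open>range ((*v) B) \<subseteq> range ((*v) A)\<close> by blast
      then show ?thesis using \<open>orth_proj A\<close> by (simp add: orth_proj_def matrix_vector_mul_assoc)
    qed
    then show ?thesis by (simp add: matrix_eq matrix_vector_mul_assoc)
  qed
  have adj_mult: "adj (A ** B) = adj B ** adj A" for A B :: "complex ^ 'n ^ 'n"
    by (simp add: adj_def matrix_matrix_mult_def vec_eq_iff mult.commute)
  have "P = Q ** P" using absorb[of Q P] assms by simp
  moreover have "Q = P ** Q" using absorb[of P Q] assms by simp
  ultimately show ?thesis
    using adj_mult[of P Q] assms by (simp add: orth_proj_def)
qed

lemma eigenvalue_listing_exists: "\<exists>l. eigenvalue_listing (T :: complex ^ 'n ^ 'n) l"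
proof -
  let ?M = "\<lambda>i j. if i = j then [:- T $ i $ j, 1:] else [:- T $ i $ j:]"
  let ?f = "\<lambda>p. of_int (sign p) * (\<Prod>i\<in>UNIV. ?M i (p i))"
  let ?q = "\<Sum>p | p permutes (UNIV :: 'n set). ?f p"
  have q: "poly ?q z = det (mat z - T)" for z
    unfolding det_def poly_sum
    by (intro sum.cong refl)
       (auto simp: poly_prod mat_def if_distrib intro!: arg_cong2[where f = "(*)"] prod.cong)
  have deg: "degree (?f p) < CARD('n)" if p: "p permutes (UNIV :: 'n set)" "p \<noteq> id" for p
  proof -
    obtain a where a: "p a \<noteq> a" using p(2) by fastforce
    have "degree (?f p) = degree (\<Prod>i\<in>UNIV. ?M i (p i))"
      by (cases "sign p = 1") (auto simp: sign_def)
    also have "\<dots> \<le> (\<Sum>i\<in>UNIV. degree (?M i (p i)))"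
      using degree_prod_sum_le[of UNIV "\<lambda>i. ?M i (p i)"] by (simp add: o_def)
    also have "\<dots> < (\<Sum>i\<in>(UNIV :: 'n set). 1)"
      by (rule sum_strict_mono_ex1) (use a in \<open>auto intro!: exI[of _ a]\<close>)
    finally show ?thesis by simp
  qed
  have did: "?f id = (\<Prod>i\<in>UNIV. [:- T $ i $ i, 1:])" by (simp add: sign_id)
  have cid: "degree (?f id) = CARD('n)" "lead_coeff (?f id) = 1"
    unfolding did lead_coeff_prod by (simp_all add: degree_prod_sum_eq)
  let ?r = "\<Sum>p\<in>{p. p permutes (UNIV :: 'n set)} - {id}. ?f p"
  have qs: "?q = ?f id + ?r"
    by (rule sum.remove) (auto simp: permutes_id)
  have r: "degree ?r < CARD('n)"
    by (rule degree_sum_less) (use deg in auto)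
  have dq: "degree ?q = CARD('n)" and lq: "lead_coeff ?q = 1"
    unfolding qs using r cid by (simp_all add: degree_add_eq_left lead_coeff_add_le coeff_eq_0)
  obtain root where root: "smult (lead_coeff ?q) (\<Prod>i<degree ?q. [:- root i, 1:]) = ?q"
    using complex_poly_decompose' by blast
  obtain h :: "'n \<Rightarrow> nat" where h: "bij_betw h UNIV {..<CARD('n)}"
    using ex_bij_betw_finite_nat[of "UNIV :: 'n set"] by (auto simp: atLeast0LessThan)
  have "det (mat z - T) = (\<Prod>i\<in>UNIV. z - root (h i))" for z
  proof -
    have "poly ?q z = poly (\<Prod>i<CARD('n). [:- root i, 1:]) z"
      using root dq lq by simp
    also have "\<dots> = (\<Prod>i<CARD('n). z - root i)" by (simp add: poly_prod)
    also have "\<dots> = (\<Prod>i\<in>UNIV. z - root (h i))"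
      using prod.reindex_bij_betw[OF h, of "\<lambda>i. z - root i"] by simp
    finally show ?thesis using q by simp
  qed
  then show ?thesis unfolding eigenvalue_listing_def by (intro exI[of _ "\<lambda>i. root (h i)"]) simp
qed

lemma eigenvalue_listing_unique:
  assumes "eigenvalue_listing T l" "eigenvalue_listing T l'"
  shows "\<exists>p. p permutes UNIV \<and> l' = l \<circ> p"
proof -
  let ?q = "\<lambda>l :: 'a \<Rightarrow> complex. \<Prod>i\<in>UNIV. [:- l i, 1:]"
  have "poly (?q l) z = poly (?q l') z" for z
    using assms by (simp add: eigenvalue_listing_def poly_prod)
  then have eq: "?q l = ?q l'" by (intro poly_ext) simp
  have pr: "proots (?q l) = image_mset l (mset_set UNIV)" for l :: "'a \<Rightarrow> complex"
    by (subst proots_prod) (auto simp: sum_unfold_sum_mset)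
  have "image_mset l (mset_set UNIV) = image_mset l' (mset_set UNIV)"
    using pr[of l] pr[of l'] eq by simp
  then obtain p where "p permutes UNIV" "\<forall>x\<in>UNIV. l x = l' (p x)"
    using image_mset_eq_implies_permutes[of UNIV l l'] by auto
  then have "l' = l \<circ> inv p" by (auto simp: fun_eq_iff permutes_inverses)
  then show ?thesis using permutes_inv \<open>p permutes UNIV\<close> by blast
qed

lemma eigenvalue_listing_eigenvalues: "eigenvalue_listing T (eigenvalues T)"
  unfolding eigenvalues_def using eigenvalue_listing_exists by (rule someI_ex)

lemma Omega_eq:
  fixes T :: "complex ^ 'n ^ 'n"
  assumes "eigenvalue_listing T l"
  shows "Omega k T = (\<Inter>S\<in>{S :: 'n set. card S = CARD('n) - k + 1}. convex hull (l ` S))"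
proof -
  obtain p where p: "p permutes UNIV" and l: "eigenvalues T = l \<circ> p"
    using eigenvalue_listing_unique[OF assms eigenvalue_listing_eigenvalues] by blast
  let ?F = "{S :: 'n set. card S = CARD('n) - k + 1}"
  have inj: "inj p" "inj (inv p)" using p permutes_inv[OF p] by (auto simp: permutes_inj)
  have "(`) p ` ?F = ?F"
  proof (intro equalityI subsetI)
    fix S assume "S \<in> ?F"
    then have "inv p ` S \<in> ?F" "S = p ` (inv p ` S)"
      using inj permutes_inverses[OF p]
      by (auto simp: card_image inj_on_subset[OF inj(2)] image_image)
    then show "S \<in> (`) p ` ?F" by blast
  qed (use inj in \<open>auto simp: card_image inj_on_subset[OF inj(1)]\<close>)
  then have "(\<Inter>S\<in>?F. convex hull (l ` S)) = (\<Inter>S\<in>(`) p ` ?F. convex hull (l ` S))" by simp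
  then show ?thesis by (simp add: Omega_def l image_comp)
qed

lemma Delta_eq:
  fixes T :: "complex ^ 'n ^ 'n"
  assumes "eigenvalue_listing T l"
  shows "Delta k T = {z. \<exists>S :: nat \<Rightarrow> 'n set. disjoint_family_on S {1..k} \<and>
                            (\<forall>i\<in>{1..k}. z \<in> convex hull (l ` S i))}"
proof -
  obtain p where p: "p permutes UNIV" and l: "eigenvalues T = l \<circ> p"
    using eigenvalue_listing_unique[OF assms eigenvalue_listing_eigenvalues] by blast
  have dis: "disjoint_family_on (\<lambda>i. f ` S i) {1..k}"
    if "inj f" "disjoint_family_on S {1..k}" for f :: "'n \<Rightarrow> 'n" and S :: "nat \<Rightarrow> 'n set"
    using that unfolding disjoint_family_on_def by (metis image_Int image_empty)
  have l': "l = eigenvalues T \<circ> inv p"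
    using p by (auto simp: l fun_eq_iff permutes_inverses)
  show ?thesis
    unfolding Delta_def
  proof (intro Collect_cong iffI; elim exE conjE)
    fix z and S :: "nat \<Rightarrow> 'n set"
    assume "disjoint_family_on S {1..k}" "\<forall>i\<in>{1..k}. z \<in> convex hull (eigenvalues T ` S i)"
    then show "\<exists>S :: nat \<Rightarrow> 'n set. disjoint_family_on S {1..k} \<and>
                 (\<forall>i\<in>{1..k}. z \<in> convex hull (l ` S i))"
      using dis[of p S] permutes_inj[OF p]
      by (intro exI[of _ "\<lambda>i. p ` S i"]) (simp add: l image_comp)
  next
    fix z and S :: "nat \<Rightarrow> 'n set"
    assume "disjoint_family_on S {1..k}" "\<forall>i\<in>{1..k}. z \<in> convex hull (l ` S i)"
    then show "\<exists>S :: nat \<Rightarrow> 'n set. disjoint_family_on S {1..k} \<and>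
                 (\<forall>i\<in>{1..k}. z \<in> convex hull (eigenvalues T ` S i))"
      using dis[of "inv p" S] permutes_inj[OF permutes_inv[OF p]]
      by (intro exI[of _ "\<lambda>i. inv p ` S i"]) (simp add: l' image_comp)
  qed
qed

end

theory Submission
  imports Defs
begin

text \<open>
  \<open>\<Delta>\<^sub>k \<subseteq> \<Lambda>\<^sub>k\<close>: convex weights on disjoint sets of eigenvalues are squared amplitudes of
  orthonormal vectors whose span compresses \<open>U\<close> to a scalar.
  \<open>\<Lambda>\<^sub>k \<subseteq> \<Omega>\<^sub>k\<close>: a subspace of dimension \<open>k\<close> meets the span of any \<open>N - k + 1\<close> eigenvectors.
  \<open>\<Omega>\<^sub>k \<subseteq> \<Delta>\<^sub>k\<close>: membership of \<open>z\<close> in \<open>\<Omega>\<^sub>k\<close> forces every closed half-plane with \<open>z\<close> on its boundary to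
  contain at least \<open>k\<close> eigenvalues. Eigenvalues can be discarded without losing this property until
  \<open>3 k\<close> are left; in cyclic order, the triangles with vertices \<open>j, j + k, j + 2 k\<close> then contain
  \<open>z\<close>. Nonemptiness is Helly's theorem, and a subspace on which the compression of \<open>U\<close> is scalar
  satisfies the Knill--Laflamme condition for the Kraus operators \<open>1\<close> and \<open>U\<close>.
\<close>

section \<open>Depth of a point and triangles containing it\<close>

text \<open>Halfspace (Tukey) depth of the origin, so the \<open>p j\<close> are positions relative
  to the point of interest, later \<open>l j - z\<close>. Taking \<open>v = 0\<close> already gives
  \<open>k \<le> card M\<close>.\<close>

definition depth_at_least :: "nat \<Rightarrow> 'i set \<Rightarrow> ('i \<Rightarrow> complex) \<Rightarrow> bool" where
  "depth_at_least k M p \<longleftrightarrow> (\<forall>v. k \<le> card {j\<in>M. 0 \<le> v \<bullet> p j})"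

text \<open>Take \<open>q\<close> with the least value of \<open>s\<close> among the elements having
  at least \<open>k + 1\<close> elements at or below them. By minimality at most \<open>k\<close>
  elements lie strictly below it, which leaves at least \<open>k + 1\<close> at or above. Ties in
  \<open>s\<close> are allowed.\<close>

lemma exists_median:
  fixes s :: "'i \<Rightarrow> real"
  assumes "finite B" "2 * k + 1 \<le> card B"
  obtains q where "q \<in> B" "k + 1 \<le> card {x\<in>B. s x \<le> s q}" "k + 1 \<le> card {x\<in>B. s q \<le> s x}"
proof -
  let ?A = "{q\<in>B. k + 1 \<le> card {x\<in>B. s x \<le> s q}}"
  have ne: "B \<noteq> {}" using assms by auto
  have "Max (s ` B) \<in> s ` B" using assms(1) ne by simp
  then obtain m where m: "m \<in> B" "s m = Max (s ` B)" by (metis imageE)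
  then have "{x\<in>B. s x \<le> s m} = B" using assms(1) by auto
  then have "m \<in> ?A" using m assms(2) by simp
  then obtain q where q: "q \<in> ?A" "\<And>r. r \<in> ?A \<Longrightarrow> s q \<le> s r"
    using arg_min_if_finite[of ?A s] assms(1)
    by (metis (no_types, lifting) arg_min_least empty_iff finite_subset mem_Collect_eq subsetI)
  let ?L = "{x\<in>B. s x < s q}"
  have "card ?L \<le> k"
  proof (rule ccontr)
    assume a: "\<not> card ?L \<le> k"
    then have "?L \<noteq> {}" by (metis card.empty le0)
    then have "Max (s ` ?L) \<in> s ` ?L" using assms(1) by simp
    then obtain r where r: "s r = Max (s ` ?L)" "r \<in> ?L" by (elim imageE) simp
    have "?L \<subseteq> {x\<in>B. s x \<le> s r}"
      unfolding r(1) using assms(1) by (auto intro!: Max_ge)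
    then have "card ?L \<le> card {x\<in>B. s x \<le> s r}" using assms(1) by (simp add: card_mono)
    then have "r \<in> ?A" using a r by simp
    then show False using q(2)[of r] r(2) by simp
  qed
  moreover have "card ?L + card {x\<in>B. s q \<le> s x} = card B"
    using assms(1) by (subst card_Un_disjoint[symmetric]) (auto intro!: arg_cong[where f = card])
  ultimately have "k + 1 \<le> card {x\<in>B. s q \<le> s x}" using assms(2) by simp
  then show ?thesis using that q(1) by blast
qed

text \<open>
  If no point could be removed, every point would lie in a closed half-plane containing exactly
  \<open>k\<close> points. Fix one such half-plane. Any other one meets its complement in an initial or
  final segment of the order by slope, so it cannot contain a median of the \<open>\<ge> 2 k + 1\<close>
  points of the complement.
\<close>
lemma depth_at_least_remove:
  assumes "finite M" "3 * k < card M" "depth_at_least k M p"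
  shows "\<exists>q\<in>M. depth_at_least k (M - {q}) p"
proof (rule ccontr)
  assume no: "\<not> ?thesis"
  define H where "H v = {j\<in>M. 0 \<le> v \<bullet> p j}" for v
  have finH: "finite (H v)" for v using assms(1) by (simp add: H_def)
  \<comment> \<open>Deleting \<open>q\<close> drops some half-plane below \<open>k\<close> points
    although it held at least \<open>k\<close> before; hence it contains \<open>q\<close> and held
    exactly \<open>k\<close>.\<close>
  have tight: "\<exists>v. q \<in> H v \<and> card (H v) = k" if "q \<in> M" for q
  proof -
    obtain v where v: "card {j\<in>M - {q}. 0 \<le> v \<bullet> p j} < k"
      using no \<open>q \<in> M\<close> by (auto simp: depth_at_least_def not_le)
    have eq: "{j\<in>M - {q}. 0 \<le> v \<bullet> p j} = H v - {q}" by (auto simp: H_def)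
    have k: "k \<le> card (H v)" using assms(3) by (simp add: depth_at_least_def H_def)
    have "q \<in> H v" using v k eq by (metis Diff_empty Diff_insert0 not_le)
    then have "card (H v - {q}) = card (H v) - 1" "card (H v) > 0"
      using finH by (auto simp: card_gt_0_iff)
    then show ?thesis using v k eq \<open>q \<in> H v\<close> by (intro exI[of _ v]) simp
  qed
  obtain q0 where "q0 \<in> M" using assms(2) by fastforce
  then obtain v where v: "card (H v) = k" using tight by blast
  define B where "B = M - H v"
  have B: "finite B" "2 * k + 1 \<le> card B"
    using assms(1,2) v finH[of v] by (auto simp: B_def card_Diff_subset H_def)
  have neg: "v \<bullet> p j < 0" if "j \<in> B" for j using that by (auto simp: B_def H_def)
  have "B \<noteq> {}" using B by auto
  then have "v \<noteq> 0" using neg by fastforce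
  \<comment> \<open>Rescaled by a positive factor to have inner product \<open>-1\<close> with
    \<open>v\<close>, the point \<open>p j\<close> has inner product \<open>s j\<close> with
    \<open>\<i> * v\<close>.\<close>
  define s where "s j = ((\<i> * v) \<bullet> p j) / - (v \<bullet> p j)" for j
  obtain q where q: "q \<in> B" "k + 1 \<le> card {x\<in>B. s x \<le> s q}" "k + 1 \<le> card {x\<in>B. s q \<le> s x}"
    using exists_median[OF B] by blast
  have "q \<in> M" using q by (simp add: B_def)
  then obtain w where w: "q \<in> H w" "card (H w) = k" using tight by blast
  \<comment> \<open>In the orthogonal basis \<open>v\<close>, \<open>\<i> * v\<close>, the condition
    \<open>0 \<le> w \<bullet> p j\<close> on \<open>B\<close> becomes
    \<open>a \<le> b * s j\<close>. The sign of \<open>b\<close> then decides whether the half-plane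
    of \<open>w\<close> contains all points of \<open>B\<close> with slope at least, or at most,
    that of \<open>q\<close>.\<close>
  define a b where "a = Re (w / v)" and "b = Im (w / v)"
  have "w = (w / v) * v" using \<open>v \<noteq> 0\<close> by simp
  also have "w / v = Complex a b" by (simp add: a_def b_def)
  finally have w_eq: "w = a *\<^sub>R v + b *\<^sub>R (\<i> * v)" by (simp add: complex_eq_iff)
  have "w \<bullet> p j = a * (v \<bullet> p j) + b * ((\<i> * v) \<bullet> p j)" for j
    unfolding w_eq by (simp add: inner_add_left)
  then have "w \<bullet> p j = - (v \<bullet> p j) * (b * s j - a)" if "j \<in> B" for j
    using neg[OF that] by (simp add: s_def field_simps)
  then have iff: "0 \<le> w \<bullet> p j \<longleftrightarrow> a \<le> b * s j" if "j \<in> B" for j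
    using neg[OF that] that
    by (smt (verit) mult_nonneg_nonneg mult_pos_neg)
  have BM: "B \<subseteq> M" by (auto simp: B_def)
  have aq: "a \<le> b * s q" using iff[OF q(1)] w(1) by (simp add: H_def)
  show False
  proof (cases "b \<ge> 0")
    case True
    have "{x\<in>B. s q \<le> s x} \<subseteq> H w"
      using iff aq BM mult_left_mono[OF _ True] unfolding H_def by (auto; smt (verit))
    then show False using q(3) w(2) card_mono[OF finH] by (metis Suc_eq_plus1 not_less_eq_eq)
  next
    case False
    then have "b \<le> 0" by simp
    have "{x\<in>B. s x \<le> s q} \<subseteq> H w"
      using iff aq BM mult_left_mono_neg[OF _ \<open>b \<le> 0\<close>] unfolding H_def by (auto; smt (verit))
    then show False using q(2) w(2) card_mono[OF finH] by (metis Suc_eq_plus1 not_less_eq_eq)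
  qed
qed

lemma depth_at_least_subset:
  assumes "finite M" "3 * k \<le> card M" "depth_at_least k M p"
  shows "\<exists>M'\<subseteq>M. card M' = 3 * k \<and> depth_at_least k M' p"
  using assms
proof (induction "card M" arbitrary: M rule: less_induct)
  case less
  show ?case
  proof (cases "card M = 3 * k")
    case True
    then show ?thesis using less.prems by blast
  next
    case False
    then obtain q where q: "q \<in> M" "depth_at_least k (M - {q}) p"
      using depth_at_least_remove[of M k p] less.prems by force
    then have "\<exists>M'\<subseteq>M - {q}. card M' = 3 * k \<and> depth_at_least k M' p"
      using less.prems False by (intro less.hyps) (auto simp: card_gt_0_iff)
    then show ?thesis by blast
  qed
qed

section \<open>Convex position of points on the circle\<close>

text \<open>Twice the signed area of the triangle with vertices \<open>cis x\<close>,
  \<open>cis y\<close>, \<open>cis z\<close>.\<close>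

definition orient :: "real \<Rightarrow> real \<Rightarrow> real \<Rightarrow> real" where
  "orient x y z = sin (y - x) + sin (z - y) - sin (z - x)"

text \<open>In half-angles the sum factors as \<open>4 * sin u * sin w * sin (u + w)\<close>, and
  \<open>u\<close>, \<open>w\<close>, \<open>u + w\<close> all lie strictly between 0 and
  pi.\<close>

lemma orient_pos:
  assumes "x < y" "y < z" "z < x + 2 * pi"
  shows "orient x y z > 0"
proof -
  define u w where "u = (y - x) / 2" and "w = (z - y) / 2"
  have "y - x = 2 * u" "z - y = 2 * w" "z - x = 2 * (u + w)"
    by (simp_all add: u_def w_def field_simps)
  then have "orient x y z = sin (2 * u) + sin (2 * w) - sin (2 * (u + w))"
    by (simp only: orient_def)
  also have "\<dots> = 2 * sin u * cos u * (1 - cos (2 * w)) + 2 * sin w * cos w * (1 - cos (2 * u))"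
    unfolding distrib_left sin_add[of "2 * u" "2 * w"] sin_double by (simp add: algebra_simps)
  also have "\<dots> = 4 * sin u * sin w * (cos u * sin w + sin u * cos w)"
    unfolding cos_double_sin by (simp add: power2_eq_square algebra_simps)
  also have "\<dots> = 4 * sin u * sin w * sin (u + w)"
    by (simp add: sin_add)
  also have "\<dots> > 0"
    using assms by (intro mult_pos_pos sin_gt_zero) (auto simp: u_def w_def field_simps)
  finally show ?thesis .
qed

text \<open>
  The two diagonals of a convex quadrilateral cross: the two sides of the equation, divided by
  their common total weight, are the crossing point.
\<close>
lemma orient_exchange:
  "orient b c d *\<^sub>R cis a + orient a b d *\<^sub>R cis c = orient a c d *\<^sub>R cis b + orient a b c *\<^sub>R cis d"
  "orient b c d + orient a b d = orient a c d + orient a b c"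
proof -
  show "orient b c d *\<^sub>R cis a + orient a b d *\<^sub>R cis c = orient a c d *\<^sub>R cis b + orient a b c *\<^sub>R cis d"
    unfolding complex_eq_iff plus_complex.sel scaleR_complex.sel cis.sel orient_def sin_diff
    by (rule conjI; algebra)
qed (simp add: orient_def)

text \<open>A half-plane meets the circle in an arc. The chords from \<open>a\<close> to
  \<open>c\<close> and from \<open>b\<close> to \<open>d\<close> cross, and at the crossing point
  the product with \<open>v\<close> would be at least \<open>r\<close> by the first chord and below
  \<open>r\<close> by the second.\<close>

lemma cis_no_alternation:
  assumes "a < b" "b < c" "c < d" "d < a + 2 * pi"
    and "r \<le> v \<bullet> cis a" "v \<bullet> cis b < r" "r \<le> v \<bullet> cis c" "v \<bullet> cis d < r"
  shows False
proof -
  have pos: "orient b c d > 0" "orient a b d > 0" "orient a c d > 0" "orient a b c > 0"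
    using assms by (auto intro!: orient_pos)
  have "(orient b c d + orient a b d) * r \<le> orient b c d * (v \<bullet> cis a) + orient a b d * (v \<bullet> cis c)"
    using pos assms by (simp add: distrib_right add_mono)
  also have "\<dots> = orient a c d * (v \<bullet> cis b) + orient a b c * (v \<bullet> cis d)"
    using arg_cong[OF orient_exchange(1)[of b c d a], of "\<lambda>x. v \<bullet> x"] by (simp add: inner_add_right)
  also have "\<dots> < (orient a c d + orient a b c) * r"
    using pos assms by (simp add: distrib_right add_strict_mono)
  finally show False using orient_exchange(2)[of b c d a] by simp
qed

text \<open>
  If \<open>z\<close> were cut off from the triangle with vertices \<open>j, j + k, j + 2 k\<close> by a half-plane,
  the at least \<open>k\<close> points beyond the cut would lie in the three gaps of \<open>k - 1\<close> points each,
  hence in two of them, and two of the vertices would separate them on the circle.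
\<close>
lemma mem_triangle_of_depth:
  assumes mono: "\<And>i j. i < j \<Longrightarrow> j < 3 * k \<Longrightarrow> \<theta> i < \<theta> j"
    and range: "\<And>i j. i < 3 * k \<Longrightarrow> j < 3 * k \<Longrightarrow> \<theta> i < \<theta> j + 2 * pi"
    and depth: "depth_at_least k {..<3 * k} (\<lambda>i. cis (\<theta> i) - z)"
    and "j < k"
  shows "z \<in> convex hull {cis (\<theta> j), cis (\<theta> (k + j)), cis (\<theta> (2 * k + j))}"
proof (rule ccontr)
  let ?T = "{cis (\<theta> j), cis (\<theta> (k + j)), cis (\<theta> (2 * k + j))}"
  assume "z \<notin> convex hull ?T"
  moreover have "closed (convex hull ?T)"
    by (intro compact_imp_closed compact_convex_hull) simp
  ultimately obtain u r where ur: "u \<bullet> z < r" "\<forall>x\<in>convex hull ?T. r < u \<bullet> x"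
    using separating_hyperplane_closed_point[OF convex_convex_hull] by metis
  \<comment> \<open>With the sign reversed, \<open>z\<close> lies on the boundary of the closed
    half-plane behind \<open>high\<close>, and all three vertices lie outside it.\<close>
  define v where "v = - u"
  define high where "high i \<longleftrightarrow> v \<bullet> z \<le> v \<bullet> cis (\<theta> i)" for i
  have low: "\<not> high j" "\<not> high (k + j)" "\<not> high (2 * k + j)"
    using ur hull_subset[of ?T convex] by (auto simp: high_def v_def)
  have alt1: False if "a < b" "b < c" "c < d" "d < 3 * k" "high a" "\<not> high b" "high c" "\<not> high d"
    for a b c d
    using that cis_no_alternation[of "\<theta> a" "\<theta> b" "\<theta> c" "\<theta> d" "v \<bullet> z" v] mono range
    by (simp add: high_def not_le)
  \<comment> \<open>The same alternation read from \<open>b\<close>: the point \<open>a\<close> is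
    moved one full turn ahead, to the end of the cyclic order.\<close>
  have alt2: False if "a < b" "b < c" "c < d" "d < 3 * k" "\<not> high a" "high b" "\<not> high c" "high d"
    for a b c d
  proof (rule cis_no_alternation)
    show "\<theta> b < \<theta> c" "\<theta> c < \<theta> d" "\<theta> d < \<theta> a + 2 * pi" "\<theta> a + 2 * pi < \<theta> b + 2 * pi"
      using that mono range by auto
    show "v \<bullet> z \<le> v \<bullet> cis (\<theta> b)" "v \<bullet> cis (\<theta> c) < v \<bullet> z" "v \<bullet> z \<le> v \<bullet> cis (\<theta> d)"
      "v \<bullet> cis (\<theta> a + 2 * pi) < v \<bullet> z"
      using that by (auto simp: high_def not_le cis_mult[symmetric])
  qed
  define X where "X = {i. i < 3 * k \<and> high i}"
  have cX: "k \<le> card X"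
    using depth unfolding depth_at_least_def X_def high_def
    by (simp add: inner_diff_right)
  \<comment> \<open>The gap \<open>G3\<close> wraps around the end of the enumeration. Its points
    come before \<open>j\<close> or after \<open>2 * k + j\<close>, which is why \<open>d13\<close>
    and \<open>d23\<close> use both alternation patterns.\<close>
  define G1 G2 G3 where "G1 = {j<..<k + j}" and "G2 = {k + j<..<2 * k + j}"
    and "G3 = {..<j} \<union> {2 * k + j<..<3 * k}"
  have cG: "card G1 < k" "card G2 < k" "card G3 < k"
  proof -
    have "card G3 = j + (k - j - 1)"
      unfolding G3_def using \<open>j < k\<close> by (subst card_Un_disjoint) auto
    then show "card G1 < k" "card G2 < k" "card G3 < k"
      using \<open>j < k\<close> by (auto simp: G1_def G2_def)
  qed
  have fin: "finite G1" "finite G2" "finite G3" by (auto simp: G1_def G2_def G3_def)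
  have XG: "i \<in> G1 \<or> i \<in> G2 \<or> i \<in> G3" if "i \<in> X" for i
  proof -
    have "i \<noteq> j" "i \<noteq> k + j" "i \<noteq> 2 * k + j" "i < 3 * k" using that low by (auto simp: X_def)
    then show ?thesis by (auto simp: G1_def G2_def G3_def)
  qed
  have nsub: "\<not> X \<subseteq> G1" "\<not> X \<subseteq> G2" "\<not> X \<subseteq> G3"
    using cX cG fin card_mono by (meson leD le_trans)+
  have d12: False if "p \<in> X" "q \<in> X" "p \<in> G1" "q \<in> G2" for p q
    using alt2[of j p "k + j" q] that low by (auto simp: X_def G1_def G2_def)
  have d13: False if "p \<in> X" "q \<in> X" "p \<in> G1" "q \<in> G3" for p q
    using alt1[of q j p "k + j"] alt2[of j p "k + j" q] that low \<open>j < k\<close>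
    by (auto simp: X_def G1_def G3_def)
  have d23: False if "p \<in> X" "q \<in> X" "p \<in> G2" "q \<in> G3" for p q
    using alt1[of q j p "2 * k + j"] alt2[of "k + j" p "2 * k + j" q] that low \<open>j < k\<close>
    by (auto simp: X_def G2_def G3_def)
  show False
    using nsub XG d12 d13 d23 by (metis subsetI)
qed

text \<open>After the reduction to \<open>3 * k\<close> points, \<open>e\<close> lists them by
  increasing \<open>Arg2pi\<close>. Distinct points of the unit circle have distinct arguments, so
  the order is strict, and arguments in [0, 2 pi) give the wrap-around bound.\<close>

lemma exists_triangles_of_depth:
  fixes l :: "'i \<Rightarrow> complex"
  assumes "finite M" "3 * k \<le> card M" "inj_on l M" "\<And>i. i \<in> M \<Longrightarrow> norm (l i) = 1"
    and "depth_at_least k M (\<lambda>i. l i - z)"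
  obtains e where "inj_on e {..<3 * k}" "e ` {..<3 * k} \<subseteq> M"
    "\<And>j. j < k \<Longrightarrow> z \<in> convex hull {l (e j), l (e (k + j)), l (e (2 * k + j))}"
proof -
  obtain M' where M': "M' \<subseteq> M" "card M' = 3 * k" "depth_at_least k M' (\<lambda>i. l i - z)"
    using depth_at_least_subset[OF assms(1,2,5)] by blast
  have fin: "finite M'" using M' assms(1) finite_subset by blast
  define g where "g i = Arg2pi (l i)" for i
  have lg: "l i = cis (g i)" if "i \<in> M'" for i
    using complex_norm_eq_1_exp[of "l i"] assms(4) M' that by (auto simp: g_def cis_conv_exp)
  have "inj_on g M'"
    using lg assms(3) M'(1) by (metis (no_types, lifting) inj_on_def subsetD)
  then have cg: "card (g ` M') = 3 * k" using M' by (simp add: card_image)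
  define L where "L = sorted_list_of_set (g ` M')"
  have L: "length L = 3 * k" "set L = g ` M'" "sorted_wrt (<) L"
    using cg fin by (auto simp: L_def strict_sorted_list_of_set)
  have "\<exists>m\<in>M'. g m = L ! i" if "i < 3 * k" for i
    using that L by (metis imageE nth_mem)
  then obtain e where e: "\<And>i. i < 3 * k \<Longrightarrow> e i \<in> M' \<and> g (e i) = L ! i" by metis
  have mono: "g (e i) < g (e j)" if "i < j" "j < 3 * k" for i j
    using that e L sorted_wrt_nth_less[OF L(3)] by simp
  have inj: "inj_on e {..<3 * k}"
    by (rule inj_onI) (metis lessThan_iff less_irrefl linorder_neqE_nat mono)
  have im: "e ` {..<3 * k} \<subseteq> M'" using e by auto
  then have eM: "e ` {..<3 * k} = M'"
    using inj M'(2) fin by (metis card_image card_lessThan card_subset_eq)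
  have depth: "depth_at_least k {..<3 * k} (\<lambda>i. cis (g (e i)) - z)"
    unfolding depth_at_least_def
  proof
    fix v
    have "k \<le> card {j\<in>M'. 0 \<le> v \<bullet> (l j - z)}" using M'(3) by (simp add: depth_at_least_def)
    also have "{j\<in>M'. 0 \<le> v \<bullet> (l j - z)} = e ` {j\<in>{..<3 * k}. 0 \<le> v \<bullet> (cis (g (e j)) - z)}"
      unfolding eM[symmetric] using lg e by auto
    also have "card \<dots> \<le> card {j\<in>{..<3 * k}. 0 \<le> v \<bullet> (cis (g (e j)) - z)}"
      by (rule card_image_le) simp
    finally show "k \<le> card {j\<in>{..<3 * k}. 0 \<le> v \<bullet> (cis (g (e j)) - z)}" .
  qed
  have range: "g i < g j + 2 * pi" for i j
    using Arg2pi_ge_0[of "l j"] Arg2pi_lt_2pi[of "l i"] by (simp add: g_def)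
  show ?thesis
  proof (rule that[OF inj])
    show "e ` {..<3 * k} \<subseteq> M" using im M'(1) by blast
    show "z \<in> convex hull {l (e j), l (e (k + j)), l (e (2 * k + j))}" if "j < k" for j
      using mem_triangle_of_depth[OF mono range depth that] that e by (simp add: lg)
  qed
qed

section \<open>Intersections of hulls: depth and nonemptiness\<close>

text \<open>If fewer than \<open>k\<close> of the points lay in a closed half-plane with
  \<open>z\<close> on its boundary, at least \<open>CARD('n) - k + 1\<close> would lie in the open
  complement, which is convex and misses \<open>z\<close>; so would their hull.\<close>

lemma depth_at_least_of_mem_hulls:
  fixes l :: "'n::finite \<Rightarrow> complex"
  assumes "k \<le> CARD('n)"
    and z: "\<And>S :: 'n set. card S = CARD('n) - k + 1 \<Longrightarrow> z \<in> convex hull (l ` S)"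
  shows "depth_at_least k UNIV (\<lambda>i. l i - z)"
  unfolding depth_at_least_def
proof (rule allI, rule ccontr)
  fix v
  let ?H = "{j\<in>UNIV. 0 \<le> v \<bullet> (l j - z)}"
  assume "\<not> k \<le> card ?H"
  then have "CARD('n) - k + 1 \<le> card (- ?H)"
    using assms(1) card_Diff_subset[of ?H UNIV] by (simp add: Compl_eq_Diff_UNIV)
  then obtain S where S: "S \<subseteq> - ?H" "card S = CARD('n) - k + 1"
    by (meson obtain_subset_with_card_n)
  have "l ` S \<subseteq> {w. v \<bullet> w < v \<bullet> z}"
    using S(1) by (auto simp: inner_diff_right not_le)
  then have "convex hull (l ` S) \<subseteq> {w. v \<bullet> w < v \<bullet> z}"
    by (rule hull_minimal) (rule convex_halfspace_lt)
  then show False using z[OF S(2)] by auto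
qed

text \<open>Each index set omits \<open>k - 1\<close> indices, so three of them omit at most
  \<open>3 * (k - 1)\<close>, fewer than \<open>CARD('n)\<close>, and share an index. Helly's
  theorem in the plane does the rest.\<close>

lemma hulls_meet:
  fixes l :: "'n::finite \<Rightarrow> complex"
  assumes "1 \<le> k" "3 * k \<le> CARD('n)"
  shows "(\<Inter>S\<in>{S :: 'n set. card S = CARD('n) - k + 1}. convex hull (l ` S)) \<noteq> {}"
proof -
  let ?F = "(\<lambda>S. convex hull (l ` S)) ` {S :: 'n set. card S = CARD('n) - k + 1}"
  have small: "\<Inter>t \<noteq> {}" if t: "t \<subseteq> ?F" "card t \<le> 3" for t
  proof -
    have "finite t" using t by (meson finite finite_imageI finite_subset)
    \<comment> \<open>Different index sets can have the same hull, so one representative per hull is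
      chosen to keep the number of index sets at most 3.\<close>
    obtain s where s: "s \<subseteq> {S :: 'n set. card S = CARD('n) - k + 1}" "inj_on (\<lambda>S. convex hull (l ` S)) s"
      "t = (\<lambda>S. convex hull (l ` S)) ` s"
      using t(1) by (meson subset_image_inj)
    have cs: "card s \<le> 3" using t(2) s by (simp add: card_image)
    have "card (\<Union>S\<in>s. - S) \<le> (\<Sum>S\<in>s. card (- S))"
      by (rule card_UN_le) simp
    also have "\<dots> \<le> (\<Sum>S\<in>s. k - 1)"
    proof (rule sum_mono)
      fix S assume "S \<in> s"
      then have "card S = CARD('n) - k + 1" using s by blast
      then show "card (- S) \<le> k - 1"
        using assms card_Diff_subset[of S UNIV] by (simp add: Compl_eq_Diff_UNIV)
    qed
    also have "\<dots> \<le> 3 * (k - 1)" using cs by simp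
    also have "\<dots> < CARD('n)" using assms by simp
    finally obtain i where "i \<notin> (\<Union>S\<in>s. - S)" by (metis UNIV_eq_I less_irrefl)
    then have "l i \<in> \<Inter>t" unfolding s(3) by (auto intro!: hull_inc)
    then show ?thesis by blast
  qed
  show ?thesis
  proof (cases "card ?F \<ge> DIM(complex) + 1")
    case True
    show ?thesis
    proof (rule Helly[OF True])
      show "\<Inter>t \<noteq> {}" if "t \<subseteq> ?F" "card t = DIM(complex) + 1" for t
        using small that by simp
    qed auto
  next
    \<comment> \<open>Helly's theorem asks for at least three sets; a smaller family falls under
      \<open>small\<close> as a whole.\<close>
    case False
    then show ?thesis by (intro small[OF subset_refl]) simp
  qed
qed

section \<open>The Hermitian inner product\<close>

lemma cinner_add_left: "cinner (x + y) w = cinner x w + cinner y w"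
  and cinner_add_right: "cinner w (x + y) = cinner w x + cinner w y"
  and cinner_scale_left: "cinner (c *s x) w = cnj c * cinner x w"
  and cinner_scale_right: "cinner w (c *s x) = c * cinner w x"
  and cinner_zero_left [simp]: "cinner 0 w = 0"
  and cinner_zero_right [simp]: "cinner w 0 = 0"
  by (simp_all add: cinner_def algebra_simps sum.distrib sum_distrib_left)

lemma cinner_sum_left: "cinner (\<Sum>i\<in>I. f i) w = (\<Sum>i\<in>I. cinner (f i) w)"
  by (induction I rule: infinite_finite_induct) (simp_all add: cinner_add_left)

lemma cinner_sum_right: "cinner w (\<Sum>i\<in>I. f i) = (\<Sum>i\<in>I. cinner w (f i))"
  by (induction I rule: infinite_finite_induct) (simp_all add: cinner_add_right)

lemma cinner_self: "cinner x x = of_real ((norm x)\<^sup>2)"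
  by (simp add: cinner_def norm_vec_def L2_set_def sum_nonneg complex_norm_square mult.commute
      flip: of_real_power)

lemma orthonormal_onD:
  "orthonormal_on I v \<Longrightarrow> i \<in> I \<Longrightarrow> j \<in> I \<Longrightarrow> cinner (v i) (v j) = (if i = j then 1 else 0)"
  by (simp add: orthonormal_on_def)

lemma orthonormal_on_subset: "orthonormal_on I v \<Longrightarrow> J \<subseteq> I \<Longrightarrow> orthonormal_on J v"
  unfolding orthonormal_on_def by blast

lemma orthonormal_on_inj_on: "orthonormal_on I v \<Longrightarrow> inj_on v I"
proof (rule inj_onI)
  fix i j
  assume "orthonormal_on I v" "i \<in> I" "j \<in> I" "v i = v j"
  then show "i = j" using orthonormal_onD[of I v i j] orthonormal_onD[of I v i i]
    by (simp split: if_splits)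
qed

text \<open>Separate index sets cover both uses: \<open>S = T\<close> gives norms and diagonal
  matrix elements, disjoint sets give orthogonality.\<close>

lemma cinner_orthonormal_combinations:
  assumes "orthonormal_on I v" "finite I" "S \<subseteq> I" "T \<subseteq> I"
  shows "cinner (\<Sum>m\<in>S. a m *s v m) (\<Sum>m\<in>T. b m *s v m) = (\<Sum>m\<in>S \<inter> T. cnj (a m) * b m)"
proof -
  have "cinner (\<Sum>m\<in>S. a m *s v m) (\<Sum>m\<in>T. b m *s v m)
      = (\<Sum>m\<in>S. \<Sum>n\<in>T. if m = n then cnj (a m) * b n else 0)"
    unfolding cinner_sum_left unfolding cinner_sum_right
  proof (intro sum.cong refl)
    fix m n assume "m \<in> S" "n \<in> T"
    then have "cinner (v m) (v n) = (if m = n then 1 else 0)"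
      using assms(3,4) by (intro orthonormal_onD[OF assms(1)]) auto
    then show "cinner (a m *s v m) (b n *s v n) = (if m = n then cnj (a m) * b n else 0)"
      by (simp add: cinner_scale_left cinner_scale_right)
  qed
  also have "\<dots> = (\<Sum>m\<in>S. if m \<in> T then cnj (a m) * b m else 0)"
    using finite_subset[OF assms(4,2)] by (intro sum.cong refl) (simp add: sum.delta)
  also have "\<dots> = (\<Sum>m\<in>S \<inter> T. cnj (a m) * b m)"
    using finite_subset[OF assms(3,2)] by (simp add: sum.inter_restrict)
  finally show ?thesis .
qed

lemma cinner_orthonormal_combination:
  assumes "orthonormal_on I v" "finite I" "j \<in> I"
  shows "cinner (v j) (\<Sum>i\<in>I. a i *s v i) = a j"
  using cinner_orthonormal_combinations[OF assms(1,2), of "{j}" I "\<lambda>_. 1" a] assms(3) by simp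

lemma orthonormal_on_independent:
  fixes v :: "'i \<Rightarrow> complex ^ 'n"
  assumes "orthonormal_on I v" "finite I"
  shows "vec.independent (v ` I)"
proof (rule vec.independent_if_scalars_zero)
  fix f x
  assume f: "(\<Sum>x\<in>v ` I. f x *s x) = 0" and "x \<in> v ` I"
  then obtain j where j: "j \<in> I" "x = v j" by blast
  have "(\<Sum>i\<in>I. f (v i) *s v i) = 0"
    using f by (simp add: sum.reindex[OF orthonormal_on_inj_on[OF assms(1)]])
  then show "f x = 0"
    using cinner_orthonormal_combination[OF assms j(1), of "\<lambda>i. f (v i)"] j(2) by simp
qed (use assms in simp)

lemma dim_span_orthonormal:
  fixes v :: "'i \<Rightarrow> complex ^ 'n"
  assumes "orthonormal_on I v" "finite I"
  shows "vec.dim (vec.span (v ` I)) = card I"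
  using vec.dim_span_eq_card_independent[OF orthonormal_on_independent[OF assms]]
  by (simp add: card_image orthonormal_on_inj_on[OF assms(1)])

lemma mem_span_orthonormal:
  fixes v :: "'i \<Rightarrow> complex ^ 'n"
  assumes "orthonormal_on I v" "finite I" "x \<in> vec.span (v ` I)"
  shows "x = (\<Sum>i\<in>I. cinner (v i) x *s v i)"
  using assms(3)
proof (induction rule: vec.span_induct_alt)
  case (step c y x)
  then obtain j where j: "j \<in> I" "y = v j" by blast
  have "(\<Sum>i\<in>I. cinner (v i) (c *s y + x) *s v i)
      = (\<Sum>i\<in>I. (if i = j then c *s v j else 0)) + (\<Sum>i\<in>I. cinner (v i) x *s v i)"
    unfolding sum.distrib[symmetric] j(2)
    by (intro sum.cong refl)
      (auto simp: cinner_add_right cinner_scale_right orthonormal_onD[OF assms(1)] j(1) vec.scale_left_distrib)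
  then show ?case using step j assms(2) by simp
qed simp

section \<open>Matrix algebra\<close>

lemma adj_adj [simp]: "adj (adj A) = A"
  by (simp add: adj_def vec_eq_iff)

lemma adj_diff: "adj (A - B) = adj A - adj B"
  and adj_cscale: "adj (cscale c A) = cscale (cnj c) (adj A)"
  by (simp_all add: adj_def cscale_def vec_eq_iff)

lemma adj_mat_1 [simp]: "adj (mat 1) = mat 1"
  by (auto simp: adj_def mat_def vec_eq_iff)

lemma adj_zero [simp]: "adj 0 = 0"
  by (simp add: adj_def vec_eq_iff)

lemma adj_mult: "adj (A ** B) = adj B ** adj A"
  by (simp add: adj_def matrix_matrix_mult_def vec_eq_iff mult.commute)

lemma cscale_mult_left: "cscale c A ** B = cscale c (A ** B)"
  and cscale_mult_right: "A ** cscale c B = cscale c (A ** B)"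
  by (simp_all add: cscale_def matrix_matrix_mult_def vec_eq_iff sum_distrib_left mult_ac)

lemma cscale_cscale: "cscale c (cscale d A) = cscale (c * d) A"
  and cscale_one [simp]: "cscale 1 A = A"
  and cscale_zero [simp]: "cscale 0 A = 0"
  and cscale_add: "cscale c (A + B) = cscale c A + cscale c B"
  and cscale_add_left: "cscale (c + d) A = cscale c A + cscale d A"
  and cscale_diff_left: "cscale (c - d) A = cscale c A - cscale d A"
  by (simp_all add: cscale_def vec_eq_iff algebra_simps)

lemma cscale_zero_right [simp]: "cscale c 0 = 0"
  by (simp add: cscale_def vec_eq_iff)

lemma cscale_vector: "cscale c A *v x = c *s (A *v x)"
  by (simp add: cscale_def matrix_vector_mult_def vec_eq_iff sum_distrib_left mult.assoc)

lemma cscale_sum: "cscale c (\<Sum>i\<in>I. f i) = (\<Sum>i\<in>I. cscale c (f i))"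
  by (induction I rule: infinite_finite_induct) (simp_all add: cscale_add)

lemma zero_matrix_mult [simp]: "(0 :: 'a::comm_ring_1 ^ 'm ^ 'n) ** A = 0"
  and matrix_mult_zero [simp]: "B ** (0 :: 'a::comm_ring_1 ^ 'm ^ 'n) = 0"
  by (simp_all add: matrix_matrix_mult_def vec_eq_iff)

lemma matrix_mult_add_left: "(A + B) ** C = A ** C + B ** (C :: 'a::comm_ring_1 ^ 'm ^ 'n)"
  and matrix_mult_diff_left: "(A - B) ** C = A ** C - B ** C"
  and matrix_mult_diff_right: "D ** (A - B) = D ** A - D ** B"
  by (simp_all add: matrix_matrix_mult_def vec_eq_iff algebra_simps sum.distrib sum_subtractf)

lemma sum_matrix_mult: "(\<Sum>i\<in>I. F i) ** (A :: complex ^ 'm ^ 'n) = (\<Sum>i\<in>I. F i ** A)"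
  by (induction I rule: infinite_finite_induct) (simp_all add: matrix_mult_add_left)

lemma trace_sum: "trace (\<Sum>i\<in>I. F i) = (\<Sum>i\<in>I. trace (F i :: complex ^ 'n ^ 'n))"
  unfolding trace_def sum_component by (rule sum.swap)

text \<open>The matrix with columns \<open>\<psi> j\<close> diagonalises \<open>U\<close>, which
  determines the characteristic polynomial. Through \<open>Omega_eq\<close> and
  \<open>Delta_eq\<close> the given eigenvalues can then replace the chosen listing
  \<open>eigenvalues U\<close>.\<close>

lemma eigenvalue_listing_of_eigenbasis:
  fixes U :: "complex ^ 'n ^ 'n"
  assumes "orthonormal_on UNIV \<psi>" "\<And>i. U *v \<psi> i = l i *s \<psi> i"
  shows "eigenvalue_listing U l"
  unfolding eigenvalue_listing_def
proof
  fix z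
  define V :: "complex ^ 'n ^ 'n" where "V = (\<chi> i j. \<psi> j $ i)"
  define D :: "complex ^ 'n ^ 'n" where "D = (\<chi> i j. if i = j then l i else 0)"
  have "adj V ** V = mat 1"
    using assms(1)
    by (simp add: orthonormal_on_def cinner_def adj_def V_def matrix_matrix_mult_def mat_def vec_eq_iff)
  then have V: "V ** adj V = mat 1" by (simp add: matrix_left_right_inverse)
  have "(U ** V) $ i $ j = l j * \<psi> j $ i" for i j
    using arg_cong[OF assms(2)[of j], of "\<lambda>x. x $ i"]
    by (simp add: V_def matrix_matrix_mult_def matrix_vector_mult_def)
  moreover have "(V ** D) $ i $ j = l j * \<psi> j $ i" for i j
    by (simp add: V_def D_def matrix_matrix_mult_def if_distrib cong: if_cong)
  ultimately have "U ** V = V ** D" by (simp add: vec_eq_iff)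
  have zz: "mat z ** A = cscale z A" "A ** mat z = cscale z A" for A :: "complex ^ 'n ^ 'n"
    by (auto simp: mat_def cscale_def matrix_matrix_mult_def vec_eq_iff if_distrib if_distribR cong: if_cong)
  have "(mat z - U) ** V = V ** (mat z - D)"
    using \<open>U ** V = V ** D\<close>
    by (simp add: matrix_mult_diff_right matrix_mult_diff_left zz)
  then have "det (mat z - U) * det V = det V * det (mat z - D)"
    by (metis det_mul)
  moreover have "det V \<noteq> 0"
    using arg_cong[OF V, of det] by (auto simp: det_mul)
  ultimately have "det (mat z - U) = det (mat z - D)" by simp
  also have "\<dots> = (\<Prod>i\<in>UNIV. z - l i)"
    by (subst det_diagonal) (auto simp: D_def mat_def)
  finally show "det (mat z - U) = (\<Prod>i\<in>UNIV. z - l i)" .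
qed

section \<open>Orthogonal projections\<close>

text \<open>The sum of the outer products \<open>|v i><v i|\<close>; for an orthonormal family it is
  the orthogonal projection onto the span.\<close>

definition frame_proj :: "'i set \<Rightarrow> ('i \<Rightarrow> complex ^ 'n) \<Rightarrow> complex ^ 'n ^ 'n" where
  "frame_proj I v = (\<chi> a b. \<Sum>i\<in>I. v i $ a * cnj (v i $ b))"

lemma frame_proj_vector: "frame_proj I v *v x = (\<Sum>i\<in>I. cinner (v i) x *s v i)"
proof -
  have "(\<Sum>b\<in>UNIV. (\<Sum>i\<in>I. v i $ a * cnj (v i $ b)) * x $ b)
      = (\<Sum>i\<in>I. (\<Sum>b\<in>UNIV. cnj (v i $ b) * x $ b) * v i $ a)" for a
    unfolding sum_distrib_right by (subst sum.swap) (simp add: mult_ac)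
  then show ?thesis
    by (simp add: frame_proj_def matrix_vector_mult_def cinner_def vec_eq_iff)
qed

lemma range_frame_proj:
  fixes v :: "'i \<Rightarrow> complex ^ 'n"
  assumes "orthonormal_on I v" "finite I"
  shows "range ((*v) (frame_proj I v)) = vec.span (v ` I)"
proof
  show "range ((*v) (frame_proj I v)) \<subseteq> vec.span (v ` I)"
    by (auto simp: frame_proj_vector intro: vec.span_sum vec.span_scale vec.span_base)
  show "vec.span (v ` I) \<subseteq> range ((*v) (frame_proj I v))"
  proof
    fix x assume "x \<in> vec.span (v ` I)"
    from mem_span_orthonormal[OF assms this] show "x \<in> range ((*v) (frame_proj I v))"
      unfolding frame_proj_vector[symmetric] by (rule range_eqI)
  qed
qed

lemma orth_proj_frame_proj:
  fixes v :: "'i \<Rightarrow> complex ^ 'n"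
  assumes "orthonormal_on I v" "finite I"
  shows "orth_proj (frame_proj I v)"
proof -
  have "frame_proj I v *v (frame_proj I v *v x) = frame_proj I v *v x" for x
  proof -
    have "frame_proj I v *v x \<in> vec.span (v ` I)" using range_frame_proj[OF assms] by blast
    from mem_span_orthonormal[OF assms this] show ?thesis
      unfolding frame_proj_vector[of I v "frame_proj I v *v x"] by (rule sym)
  qed
  then have "frame_proj I v ** frame_proj I v = frame_proj I v"
    by (simp add: matrix_eq flip: matrix_vector_mul_assoc)
  then show ?thesis
    by (simp add: orth_proj_def adj_def frame_proj_def vec_eq_iff mult.commute)
qed

definition cnj_vec :: "complex ^ 'n \<Rightarrow> complex ^ 'n" where
  "cnj_vec x = (\<chi> i. cnj (x $ i))"

lemma cnj_vec_cnj_vec [simp]: "cnj_vec (cnj_vec x) = x"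
  by (simp add: cnj_vec_def vec_eq_iff)

text \<open>Conjugation is conjugate-linear, so it still carries a basis of \<open>X\<close> to a
  spanning set for the image. Since it is an involution, equality follows by applying the bound
  twice.\<close>

lemma dim_cnj_vec_le: "vec.dim (cnj_vec ` X) \<le> vec.dim X"
proof -
  obtain B where B: "B \<subseteq> X" "vec.independent B" "X \<subseteq> vec.span B" "card B = vec.dim X"
    using vec.basis_exists by blast
  have "cnj_vec x \<in> vec.span (cnj_vec ` B)" if "x \<in> vec.span B" for x
    using that
  proof (induction rule: vec.span_induct_alt)
    case base
    have "cnj_vec 0 = 0" by (simp add: cnj_vec_def vec_eq_iff)
    then show ?case using vec.span_zero by metis
  next
    case (step c x y)
    have "cnj_vec (c *s x + y) = cnj c *s cnj_vec x + cnj_vec y"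
      by (simp add: cnj_vec_def vec_eq_iff)
    then show ?case using step by (simp add: vec.span_add vec.span_scale vec.span_base)
  qed
  then have "cnj_vec ` X \<subseteq> vec.span (cnj_vec ` B)" using B(3) by blast
  moreover have "finite B" using B(2) by (rule vec.finiteI_independent)
  ultimately have "vec.dim (cnj_vec ` X) \<le> card (cnj_vec ` B)" by (intro vec.dim_le_card) auto
  also have "\<dots> \<le> vec.dim X" using card_image_le[OF \<open>finite B\<close>] B(4) by metis
  finally show ?thesis .
qed

lemma dim_cnj_vec: "vec.dim (cnj_vec ` X) = vec.dim X"
  using dim_cnj_vec_le[of X] dim_cnj_vec_le[of "cnj_vec ` X"] by (simp add: image_image)

text \<open>
  The library defines \<open>rank\<close> by the rows and identifies it with the dimension of the range for
  real matrices only. The rows of a Hermitian matrix are the conjugates of its columns.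
\<close>
lemma rank_orth_proj:
  fixes P :: "complex ^ 'n ^ 'n"
  assumes "orth_proj P"
  shows "rank P = vec.dim (range ((*v) P))"
proof -
  have "row i P = cnj_vec (column i P)" for i
  proof -
    have "adj P $ i $ j = P $ i $ j" for j using assms by (simp add: orth_proj_def)
    then show ?thesis by (simp add: row_def column_def cnj_vec_def vec_eq_iff adj_def)
  qed
  then have "rows P = cnj_vec ` columns P" by (auto simp: rows_def columns_def)
  then have "rank P = vec.dim (columns P)" by (simp add: row_rank_def_gen dim_cnj_vec)
  also have "vec.span (columns P) = range ((*v) P)"
  proof
    have "columns P \<subseteq> range ((*v) P)"
    proof -
      have "column i P = P *v axis i 1" for i
        by (simp add: column_def matrix_vector_mult_def axis_def vec_eq_iff if_distrib cong: if_cong)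
      then show ?thesis by (auto simp: columns_def)
    qed
    then show "vec.span (columns P) \<subseteq> range ((*v) P)"
      by (intro vec.span_minimal vec.subspace_image vec.subspace_UNIV)
    show "range ((*v) P) \<subseteq> vec.span (columns P)"
      by (auto intro: matrix_vector_mult_in_columnspace_gen)
  qed
  then have "vec.dim (columns P) = vec.dim (range ((*v) P))" by (metis vec.dim_span)
  finally show ?thesis .
qed

section \<open>Quantum operations in Kraus form\<close>

lemma sum_mem_nonneg_Reals:
  "(\<And>i. i \<in> I \<Longrightarrow> f i \<in> \<real>\<^sub>\<ge>\<^sub>0) \<Longrightarrow> (\<Sum>i\<in>I. f i) \<in> (\<real>\<^sub>\<ge>\<^sub>0 :: complex set)"
  by (induction I rule: infinite_finite_induct) (auto intro: nonneg_Reals_add_I)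

text \<open>Adjoints move the Kraus operators into the test vectors: the block form of the output is
  a sum of block forms of \<open>X\<close>, the one for \<open>l\<close> taken at the vectors
  \<open>adj (K l) *v v i\<close>. Cyclicity of the trace turns the hypothesis into trace
  preservation.\<close>

lemma quantum_operation_kraus:
  fixes K :: "'i \<Rightarrow> complex ^ 'n ^ 'n"
  assumes "(\<Sum>i\<in>I. adj (K i) ** K i) = mat 1"
  shows "quantum_operation (\<lambda>A. \<Sum>i\<in>I. K i ** A ** adj (K i))"
  unfolding quantum_operation_def
proof (intro conjI allI)
  show "completely_positive (\<lambda>A. \<Sum>i\<in>I. K i ** A ** adj (K i))"
    unfolding completely_positive_def block_positive_def
  proof (intro allI impI)
    fix m and X :: "nat \<Rightarrow> nat \<Rightarrow> complex ^ 'n ^ 'n" and v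
    assume X: "\<forall>v. (\<Sum>i<m. \<Sum>j<m. cinner (v i) (X i j *v v j)) \<in> \<real>\<^sub>\<ge>\<^sub>0"
    have sv: "(\<Sum>i\<in>I. F i) *v x = (\<Sum>i\<in>I. F i *v x)" for F :: "_ \<Rightarrow> complex ^ 'n ^ 'n" and x
      by (induction I rule: infinite_finite_induct) (simp_all add: matrix_vector_mult_add_rdistrib)
    have "(\<Sum>i<m. \<Sum>j<m. cinner (v i) ((\<Sum>l\<in>I. K l ** X i j ** adj (K l)) *v v j))
        = (\<Sum>i<m. \<Sum>j<m. \<Sum>l\<in>I. cinner (adj (K l) *v v i) (X i j *v (adj (K l) *v v j)))"
      by (simp add: sv cinner_sum_right cinner_adj flip: matrix_vector_mul_assoc)
    also have "\<dots> = (\<Sum>i<m. \<Sum>l\<in>I. \<Sum>j<m. cinner (adj (K l) *v v i) (X i j *v (adj (K l) *v v j)))"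
      by (intro sum.cong refl sum.swap)
    also have "\<dots> = (\<Sum>l\<in>I. \<Sum>i<m. \<Sum>j<m. cinner (adj (K l) *v v i) (X i j *v (adj (K l) *v v j)))"
      by (rule sum.swap)
    also have "\<dots> \<in> \<real>\<^sub>\<ge>\<^sub>0"
      by (rule sum_mem_nonneg_Reals) (rule X[rule_format])
    finally show "(\<Sum>i<m. \<Sum>j<m. cinner (v i) ((\<Sum>l\<in>I. K l ** X i j ** adj (K l)) *v v j)) \<in> \<real>\<^sub>\<ge>\<^sub>0" .
  qed
next
  fix A
  have "trace (K i ** A ** adj (K i)) = trace (adj (K i) ** K i ** A)" for i
    by (metis matrix_mul_assoc trace_mul_sym)
  then have "trace (\<Sum>i\<in>I. K i ** A ** adj (K i)) = trace ((\<Sum>i\<in>I. adj (K i) ** K i) ** A)"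
    by (simp add: trace_sum sum_matrix_mult)
  then show "trace (\<Sum>i\<in>I. K i ** A ** adj (K i)) = trace A"
    by (simp add: assms)
qed (simp_all add: matrix_add_ldistrib matrix_mult_add_left sum.distrib cscale_sum
    cscale_mult_left cscale_mult_right)

text \<open>Here \<open>V\<close> is an error and \<open>K\<close> one Kraus operator of a recovery.
  If \<open>K ** V\<close> acts on the code as the scalar \<open>c\<close>, the adjoint identity
  supplies \<open>cnj c\<close> on the right, so this branch returns the code state with weight
  |c|^2.\<close>

lemma kraus_on_code:
  assumes "adj P = P" "K ** V ** P = cscale c P"
  shows "K ** (V ** (P ** A ** P) ** adj V) ** adj K = cscale (c * cnj c) (P ** A ** P)"
proof -
  have "P ** adj V ** adj K = cscale (cnj c) P"
    using arg_cong[OF assms(2), of adj] assms(1) by (simp add: adj_mult adj_cscale matrix_mul_assoc)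
  then have "K ** V ** P ** A ** (P ** adj V ** adj K) = cscale (c * cnj c) (P ** A ** P)"
    unfolding assms(2) by (simp add: cscale_mult_left cscale_mult_right cscale_cscale mult.commute)
  then show ?thesis by (simp add: matrix_mul_assoc)
qed

definition mixed_unitary :: "real \<Rightarrow> complex ^ 'n ^ 'n \<Rightarrow> complex ^ 'n ^ 'n \<Rightarrow> complex ^ 'n ^ 'n" where
  "mixed_unitary p U \<rho> = cscale (of_real p) \<rho> + cscale (of_real (1 - p)) (U ** \<rho> ** adj U)"

lemma quantum_operation_mixed_unitary:
  assumes "unitary U" "0 \<le> p" "p \<le> 1"
  shows "quantum_operation (mixed_unitary p U)"
proof -
  define K where
    "K b = (if b then cscale (of_real (sqrt p)) (mat 1) else cscale (of_real (sqrt (1 - p))) U)" for b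
  have sq: "complex_of_real (sqrt x) * complex_of_real (sqrt x) = of_real x" if "0 \<le> x" for x
    using that by (simp flip: of_real_mult)
  have "(\<Sum>b\<in>UNIV. adj (K b) ** K b) = mat 1"
    using assms
    by (simp add: K_def UNIV_bool adj_cscale cscale_mult_left cscale_mult_right cscale_cscale sq
        unitary_def flip: cscale_add_left)
  then have "quantum_operation (\<lambda>A. \<Sum>b\<in>UNIV. K b ** A ** adj (K b))"
    by (rule quantum_operation_kraus)
  also have "(\<lambda>A. \<Sum>b\<in>UNIV. K b ** A ** adj (K b)) = mixed_unitary p U"
    using assms
    by (auto simp: fun_eq_iff mixed_unitary_def K_def UNIV_bool adj_cscale cscale_mult_left
        cscale_mult_right cscale_cscale sq)
  finally show ?thesis .
qed

text \<open>
  Knill--Laflamme: on the code \<open>U\<close> acts as \<open>z + s W\<close>, where \<open>|z|\<^sup>2 + s\<^sup>2 = 1\<close> and \<open>W\<close> maps the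
  code isometrically onto a subspace orthogonal to it. The recovery applies the adjoint of
  \<open>W\<close> on that subspace. If \<open>s = 0\<close>, then \<open>\<E>\<close> fixes the code already.
\<close>
lemma correctable_of_compression:
  fixes U :: "complex ^ 'n ^ 'n"
  assumes "unitary U" and P: "orth_proj P" and compr: "P ** U ** P = cscale z P"
  shows "correctable (mixed_unitary p U) (range ((*v) P))"
proof -
  have aP: "adj P = P" and PP: "P ** P = P" using P by (simp_all add: orth_proj_def)
  have UU: "adj U ** U = mat 1" using assms(1) by (simp add: unitary_def)
  define d where "d = 1 - z * cnj z"
  \<comment> \<open>\<open>W0\<close> is the component of \<open>U ** P\<close> orthogonal to the
    code, and \<open>d\<close> is the factor by which it scales squared norms on the code, as
    \<open>W0W0\<close> shows.\<close>
  define W0 where "W0 = U ** P - cscale z P"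
  have compr': "P ** adj U ** P = cscale (cnj z) P"
    using arg_cong[OF compr, of adj] by (simp add: adj_mult adj_cscale aP matrix_mul_assoc)
  have PW0: "P ** W0 = 0"
    by (simp add: W0_def matrix_mult_diff_right cscale_mult_right PP compr matrix_mul_assoc)
  have W0P: "W0 ** P = W0"
    by (simp add: W0_def matrix_mult_diff_left cscale_mult_left PP flip: matrix_mul_assoc)
  have aW0: "adj W0 = P ** adj U - cscale (cnj z) P"
    by (simp add: W0_def adj_diff adj_mult adj_cscale aP)
  have aW0P: "adj W0 ** P = 0"
    using arg_cong[OF PW0, of adj] by (simp add: adj_mult aP)
  have aW0U: "adj W0 ** (U ** P) = cscale d P"
  proof -
    have "adj W0 ** (U ** P) = P ** (adj U ** U) ** P - cscale (cnj z) (P ** U ** P)"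
      by (simp add: aW0 matrix_mult_diff_left cscale_mult_left matrix_mul_assoc)
    also have "\<dots> = cscale d P"
      by (simp add: UU PP compr cscale_cscale d_def cscale_diff_left mult.commute)
    finally show ?thesis .
  qed
  have W0W0: "adj W0 ** W0 = cscale d P"
    using aW0U aW0P by (subst (2) W0_def) (simp add: matrix_mult_diff_right cscale_mult_right)
  have "\<exists>\<R>. quantum_operation \<R> \<and> (\<forall>A. \<R> (mixed_unitary p U (P ** A ** P)) = P ** A ** P)"
  proof (cases "W0 = 0")
    case True
    \<comment> \<open>Since \<open>P\<close> may be zero, \<open>d = 0\<close> cannot be concluded;
      \<open>cscale d P = 0\<close> is enough for conjugation by \<open>U\<close> to fix the code
      states.\<close>
    then have UP: "mat 1 ** U ** P = cscale z P" and dP: "cscale d P = 0"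
      using W0W0 by (simp_all add: W0_def)
    have "quantum_operation (\<lambda>A. \<Sum>i\<in>{()}. mat 1 ** A ** adj (mat 1) :: complex ^ 'n ^ 'n)"
      by (rule quantum_operation_kraus) simp
    moreover have "mixed_unitary p U (P ** A ** P) = P ** A ** P" for A
    proof -
      have "cscale (1 - z * cnj z) (P ** A ** P) = 0"
        using dP unfolding d_def by (simp flip: cscale_mult_left)
      then have "cscale (z * cnj z) (P ** A ** P) = P ** A ** P" by (simp add: cscale_diff_left)
      then have "U ** (P ** A ** P) ** adj U = P ** A ** P"
        using kraus_on_code[OF aP UP] by simp
      then show ?thesis unfolding mixed_unitary_def by (simp flip: cscale_add_left)
    qed
    ultimately show ?thesis by auto
  next
    case False
    \<comment> \<open>This vector forces \<open>d\<close> to be positive, because |W0 x|^2 = d |P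
      x|^2; only then can \<open>W0\<close> be normalised to \<open>W\<close>.\<close>
    then obtain x where x: "W0 *v x \<noteq> 0" by (metis matrix_eq matrix_vector_mult_0)
    have dr: "d = of_real (1 - (norm z)\<^sup>2)"
      unfolding d_def by (simp add: complex_norm_square del: of_real_power)
    then have cd: "cnj d = d" by simp
    have dx: "complex_of_real ((norm (W0 *v x))\<^sup>2) = d * of_real ((norm (P *v x))\<^sup>2)"
    proof -
      have "cinner (W0 *v x) (W0 *v x) = cinner (adj (adj W0 ** W0) *v x) x"
        by (simp add: cinner_adj matrix_vector_mul_assoc adj_mult)
      also have "\<dots> = d * cinner (P *v x) (P *v x)"
        unfolding W0W0
        by (simp add: adj_cscale aP cscale_vector cinner_scale_left cinner_adj cd
            matrix_vector_mul_assoc PP)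
      finally show ?thesis by (simp add: cinner_self)
    qed
    have "(norm (W0 *v x))\<^sup>2 = (1 - (norm z)\<^sup>2) * (norm (P *v x))\<^sup>2"
      using dx unfolding dr of_real_mult[symmetric] of_real_eq_iff .
    moreover have "0 < (norm (W0 *v x))\<^sup>2" using x by simp
    ultimately have pos: "1 - (norm z)\<^sup>2 > 0"
      by (metis zero_less_mult_pos2 mult_zero_right zero_le_power2 order_le_less)
    define s where "s = sqrt (1 - (norm z)\<^sup>2)"
    have s: "s > 0" "complex_of_real s * of_real s = d"
      using pos by (simp_all add: s_def dr flip: of_real_mult)
    have sd: "of_real (inverse s) * of_real (inverse s) * d = 1" "of_real (inverse s) * d = of_real s"
      unfolding s(2)[symmetric] using s(1) by (simp_all add: field_simps)
    define W where "W = cscale (of_real (inverse s)) W0"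
    have aW: "adj W = cscale (of_real (inverse s)) (adj W0)" by (simp add: W_def adj_cscale)
    have aWP: "adj W ** P = 0" by (simp add: aW cscale_mult_left aW0P)
    have WP: "W ** P = W" by (simp add: W_def cscale_mult_left W0P)
    have PW: "P ** W = 0" by (simp add: W_def cscale_mult_right PW0)
    have WW: "adj W ** W = P"
      unfolding aW unfolding W_def cscale_mult_left cscale_mult_right W0W0 cscale_cscale
      using sd(1) by (simp add: mult.assoc)
    have aWU: "adj W ** U ** P = cscale (of_real s) P"
      unfolding aW cscale_mult_left matrix_mul_assoc[symmetric] aW0U cscale_cscale sd(2) ..
    have UP: "U ** P = cscale z P + cscale (of_real s) W"
      using s(1) by (simp add: W_def W0_def cscale_cscale flip: of_real_mult)
    \<comment> \<open>\<open>F\<close> projects onto what remains beside the code and the range of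
      \<open>W\<close>. It makes the recovery trace preserving and annihilates both \<open>P\<close>
      and \<open>U ** P\<close>.\<close>
    define F where "F = mat 1 - P - W ** adj W"
    have FP: "F ** P = 0"
      by (simp add: F_def matrix_mult_diff_left PP aWP flip: matrix_mul_assoc)
    have FW: "F ** W = 0"
      by (simp add: F_def matrix_mult_diff_left PW WW WP flip: matrix_mul_assoc)
    have aF: "adj F = F" by (simp add: F_def adj_diff adj_mult aP)
    have FWa: "F ** (W ** adj W) = 0" by (simp add: FW matrix_mul_assoc)
    have FF: "F ** F = F"
    proof -
      have "F ** F = F ** mat 1 - F ** P - F ** (W ** adj W)"
        by (subst (2) F_def) (simp add: matrix_mult_diff_right)
      then show ?thesis by (simp add: FP FWa)
    qed
    define K where "K = (\<lambda>_ :: nat. F)(0 := P, 1 := adj W)"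
    define \<R> where "\<R> A = (\<Sum>i\<in>{0, 1, 2}. K i ** A ** adj (K i))" for A
    have qR: "quantum_operation \<R>"
      unfolding \<R>_def
      by (rule quantum_operation_kraus) (simp add: K_def aP PP aF FF, simp add: F_def)
    \<comment> \<open>Both errors, \<open>mat 1\<close> and \<open>U\<close>, are treated at once:
      the three recovery branches return the code state with weights |c|^2, |c'|^2 and 0, which add
      up to 1.\<close>
    have on_code: "\<R> (V ** (P ** A ** P) ** adj V) = P ** A ** P"
      if "P ** V ** P = cscale c P" "adj W ** V ** P = cscale c' P" "F ** V ** P = 0"
        "c * cnj c + c' * cnj c' = 1" for V A c c'
    proof -
      have "F ** V ** P = cscale 0 P" using that(3) by simp
      from kraus_on_code[OF aP that(1), of A] kraus_on_code[OF aP that(2), of A]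
        kraus_on_code[OF aP this, of A]
      have "\<R> (V ** (P ** A ** P) ** adj V) = cscale (c * cnj c + c' * cnj c') (P ** A ** P)"
        by (simp add: \<R>_def K_def cscale_add_left aP)
      then show ?thesis using that(4) by simp
    qed
    have R1: "\<R> (P ** A ** P) = P ** A ** P" for A
      using on_code[of "mat 1" 1 0 A] by (simp add: PP aWP FP)
    have FU: "F ** U ** P = 0"
      by (simp add: UP matrix_add_ldistrib cscale_mult_right FP FW flip: matrix_mul_assoc)
    have "z * cnj z + of_real s * cnj (of_real s) = 1"
      unfolding complex_cnj_complex_of_real s(2) by (simp add: d_def)
    from on_code[OF compr aWU FU this]
    have RU: "\<R> (U ** (P ** A ** P) ** adj U) = P ** A ** P" for A .
    have "\<R> (mixed_unitary p U (P ** A ** P)) = P ** A ** P" for A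
    proof -
      have "\<R> (mixed_unitary p U (P ** A ** P))
          = cscale (of_real p) (\<R> (P ** A ** P)) + cscale (of_real (1 - p)) (\<R> (U ** (P ** A ** P) ** adj U))"
        using qR by (simp add: quantum_operation_def mixed_unitary_def)
      then show ?thesis unfolding R1 RU by (simp flip: cscale_add_left)
    qed
    then show ?thesis using qR by blast
  qed
  then show ?thesis
    unfolding correctable_def using P by auto
qed

section \<open>Higher-rank numerical range of a normal matrix\<close>

text \<open>The dimensions of the range of \<open>P\<close> and of the span of the eigenvectors in
  \<open>S\<close> add up to more than \<open>CARD('n)\<close>, so they share some
  \<open>x \<noteq> 0\<close>. Then z |x|^2 = <x, U x>, and expanding \<open>x\<close> in
  eigenvectors gives the convex weights |c_i|^2 / |x|^2.\<close>

lemma mem_convex_hull_of_mem_Lambda: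
  fixes U :: "complex ^ 'n ^ 'n" and \<psi> :: "'n \<Rightarrow> complex ^ 'n"
  assumes "orthonormal_on UNIV \<psi>" "\<And>i. U *v \<psi> i = l i *s \<psi> i"
    and "z \<in> Lambda k U" "card S = CARD('n) - k + 1"
  shows "z \<in> convex hull (l ` S)"
proof -
  obtain P where P: "orth_proj P" "rank P = k" "P ** U ** P = cscale z P"
    using assms(3) by (auto simp: Lambda_def)
  define R where "R = range ((*v) P)"
  define V where "V = vec.span (\<psi> ` S)"
  have on: "orthonormal_on S \<psi>" using assms(1) by (rule orthonormal_on_subset) simp
  have "vec.dim R = k" using rank_orth_proj[OF P(1)] P(2) by (simp add: R_def)
  moreover have "vec.dim V = CARD('n) - k + 1"
    using dim_span_orthonormal[OF on finite] assms(4) by (simp add: V_def)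
  moreover have "vec.subspace R" "vec.subspace V"
    by (auto simp: R_def V_def intro: vec.subspace_image vec.subspace_UNIV)
  moreover have "vec.dim {x + y |x y. x \<in> R \<and> y \<in> V} \<le> CARD('n)"
    by (rule dim_subset_UNIV_cart_gen)
  ultimately have "vec.dim (R \<inter> V) \<noteq> 0"
    using vec.dim_sums_Int[of R V] by linarith
  then have "\<not> R \<inter> V \<subseteq> {0}" by (simp add: vec.dim_eq_0)
  then obtain x where x: "x \<in> R" "x \<in> V" "x \<noteq> 0" by blast
  define c where "c i = cinner (\<psi> i) x" for i
  have xc: "x = (\<Sum>i\<in>S. c i *s \<psi> i)"
    using mem_span_orthonormal[OF on _ x(2)[unfolded V_def]] by (simp add: c_def)
  have Ux: "U *v x = (\<Sum>i\<in>S. (c i * l i) *s \<psi> i)"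
    by (subst xc) (simp add: vec.sum vec.scale assms(2))
  obtain y where y: "x = P *v y" using x(1) by (auto simp: R_def)
  have Px: "P *v x = x" using P(1) unfolding y orth_proj_def by (simp add: matrix_vector_mul_assoc)
  have ns: "complex_of_real ((norm x)\<^sup>2) = (\<Sum>i\<in>S. of_real ((norm (c i))\<^sup>2))"
  proof -
    have "cinner x x = (\<Sum>i\<in>S. cnj (c i) * c i)"
      using cinner_orthonormal_combinations[OF on _ subset_refl subset_refl, of c c] by (simp flip: xc)
    then show ?thesis
      unfolding cinner_self by (simp add: complex_norm_square mult.commute del: of_real_power)
  qed
  have "z * of_real ((norm x)\<^sup>2) = cinner x (cscale z P *v x)"
    by (simp add: cscale_vector Px cinner_scale_right cinner_self)
  also have "\<dots> = cinner x (P *v (U *v (P *v x)))"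
    by (simp add: P(3)[symmetric] matrix_vector_mul_assoc matrix_mul_assoc)
  also have "\<dots> = cinner x (U *v x)"
    using P(1) Px by (simp add: cinner_adj orth_proj_def)
  also have "\<dots> = (\<Sum>i\<in>S. cnj (c i) * (c i * l i))"
    unfolding Ux
    using cinner_orthonormal_combinations[OF on _ subset_refl subset_refl, of c "\<lambda>i. c i * l i"]
    by (simp flip: xc)
  also have "\<dots> = (\<Sum>i\<in>S. of_real ((norm (c i))\<^sup>2) * l i)"
    by (simp add: complex_norm_square mult_ac del: of_real_power)
  finally have zx: "z * of_real ((norm x)\<^sup>2) = (\<Sum>i\<in>S. of_real ((norm (c i))\<^sup>2) * l i)" .
  have nx: "(norm x)\<^sup>2 > 0" using x(3) by simp
  define w where "w i = (norm (c i))\<^sup>2 / (norm x)\<^sup>2" for i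
  have "(norm x)\<^sup>2 = (\<Sum>i\<in>S. (norm (c i))\<^sup>2)"
    using ns unfolding of_real_sum[symmetric] of_real_eq_iff .
  then have w1: "sum w S = 1" using nx by (simp add: w_def flip: sum_divide_distrib)
  have w0: "0 \<le> w i" for i by (simp add: w_def)
  have "(\<Sum>i\<in>S. w i *\<^sub>R l i) = (\<Sum>i\<in>S. of_real ((norm (c i))\<^sup>2) * l i) / of_real ((norm x)\<^sup>2)"
    by (simp add: w_def scaleR_conv_of_real sum_divide_distrib)
  also have "\<dots> = z" unfolding zx[symmetric] using x(3) by simp
  finally have "z = (\<Sum>i\<in>S. w i *\<^sub>R l i)" by simp
  also have "\<dots> \<in> convex hull (l ` S)"
    by (rule convex_sum) (auto simp: w1 w0 intro: hull_inc)
  finally show ?thesis .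
qed

text \<open>Passes from matrix elements of \<open>U\<close> in the frame to the operator identity
  demanded by \<open>Lambda\<close> and by \<open>correctable_of_compression\<close>.\<close>

lemma frame_proj_compression:
  fixes U :: "complex ^ 'n ^ 'n"
  assumes "finite I"
    and "\<And>i j. i \<in> I \<Longrightarrow> j \<in> I \<Longrightarrow> cinner (v i) (U *v v j) = (if i = j then z else 0)"
  shows "frame_proj I v ** U ** frame_proj I v = cscale z (frame_proj I v)"
proof -
  have "frame_proj I v *v (U *v (frame_proj I v *v x)) = z *s (frame_proj I v *v x)" for x
  proof -
    have "cinner (v i) (U *v (frame_proj I v *v x)) = z * cinner (v i) x" if "i \<in> I" for i
    proof -
      have "cinner (v i) (U *v (frame_proj I v *v x))
          = (\<Sum>j\<in>I. cinner (v j) x * cinner (v i) (U *v v j))"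
        by (simp add: frame_proj_vector vec.sum vec.scale cinner_sum_right cinner_scale_right)
      also have "\<dots> = (\<Sum>j\<in>I. if i = j then z * cinner (v j) x else 0)"
        using assms(2)[OF that] by (intro sum.cong) auto
      finally show ?thesis using assms(1) that by simp
    qed
    then show ?thesis
      by (simp add: frame_proj_vector[of I v "U *v _"] frame_proj_vector[of I v x] vec.scale_sum_right)
  qed
  then show ?thesis by (simp add: matrix_eq cscale_vector flip: matrix_vector_mul_assoc)
qed

text \<open>
  The square roots of the convex weights are amplitudes, so that the diagonal matrix elements of
  \<open>U\<close> are the convex combinations. Disjointness kills the off-diagonal ones.
\<close>
lemma sqrt_combinations:
  fixes U :: "complex ^ 'n ^ 'n" and u :: "'i \<Rightarrow> 'n \<Rightarrow> real"
  assumes "orthonormal_on UNIV \<psi>" "\<And>i. U *v \<psi> i = l i *s \<psi> i"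
    and "disjoint_family_on S I"
    and u: "\<And>j m. j \<in> I \<Longrightarrow> m \<in> S j \<Longrightarrow> 0 \<le> u j m" "\<And>j. j \<in> I \<Longrightarrow> (\<Sum>m\<in>S j. u j m) = 1"
      "\<And>j. j \<in> I \<Longrightarrow> (\<Sum>m\<in>S j. of_real (u j m) * l m) = z"
    and \<phi>: "\<And>j. j \<in> I \<Longrightarrow> \<phi> j = (\<Sum>m\<in>S j. of_real (sqrt (u j m)) *s \<psi> m)"
  shows "orthonormal_on I \<phi>"
    and "\<And>i j. i \<in> I \<Longrightarrow> j \<in> I \<Longrightarrow> cinner (\<phi> i) (U *v \<phi> j) = (if i = j then z else 0)"
proof -
  have sq: "complex_of_real (sqrt (u j m)) * of_real (sqrt (u j m)) = of_real (u j m)"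
    if "j \<in> I" "m \<in> S j" for j m
    using u(1)[OF that] by (simp flip: of_real_mult)
  have comb: "cinner (\<phi> i) (\<Sum>m\<in>S j. (of_real (sqrt (u j m)) * b m) *s \<psi> m)
      = (if i = j then \<Sum>m\<in>S j. of_real (u j m) * b m else 0)" if "i \<in> I" "j \<in> I" for i j b
  proof -
    have "cinner (\<phi> i) (\<Sum>m\<in>S j. (of_real (sqrt (u j m)) * b m) *s \<psi> m)
        = (\<Sum>m\<in>S i \<inter> S j. of_real (sqrt (u i m)) * (of_real (sqrt (u j m)) * b m))"
      unfolding \<phi>[OF that(1)]
      using cinner_orthonormal_combinations[OF assms(1), of "S i" "S j"] by simp
    also have "\<dots> = (if i = j then \<Sum>m\<in>S j. of_real (u j m) * b m else 0)"
    proof (cases "i = j")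
      case True
      then show ?thesis
        using sq[OF that(2)] by (simp flip: mult.assoc)
    next
      case False
      then have "S i \<inter> S j = {}" using assms(3) that by (simp add: disjoint_family_on_def)
      then show ?thesis using False by simp
    qed
    finally show ?thesis .
  qed
  show "orthonormal_on I \<phi>"
    unfolding orthonormal_on_def
  proof (intro ballI)
    fix i j assume ij: "i \<in> I" "j \<in> I"
    have "(\<Sum>m\<in>S j. complex_of_real (u j m)) = 1"
      using u(2)[OF ij(2)] by (simp flip: of_real_sum)
    then show "cinner (\<phi> i) (\<phi> j) = (if i = j then 1 else 0)"
      using comb[OF ij, of "\<lambda>_. 1"] by (simp add: \<phi>[OF ij(2)])
  qed
  show "cinner (\<phi> i) (U *v \<phi> j) = (if i = j then z else 0)" if "i \<in> I" "j \<in> I" for i j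
  proof -
    have "U *v \<phi> j = (\<Sum>m\<in>S j. (of_real (sqrt (u j m)) * l m) *s \<psi> m)"
      by (simp add: \<phi>[OF that(2)] vec.sum vec.scale assms(2))
    then show ?thesis using comb[OF that, of l] u(3)[OF that(2)] by simp
  qed
qed

text \<open>The hulls provide weights on eigenvalues; injectivity of \<open>l\<close> carries them
  over to indices, where disjointness is available. The projection is the one onto the span of the
  vectors from \<open>sqrt_combinations\<close>.\<close>

lemma mem_Lambda_of_disjoint_hulls:
  fixes U :: "complex ^ 'n ^ 'n" and \<psi> :: "'n \<Rightarrow> complex ^ 'n"
  assumes "orthonormal_on UNIV \<psi>" "\<And>i. U *v \<psi> i = l i *s \<psi> i" "inj l"
    and "finite I" "disjoint_family_on S I" "\<And>i. i \<in> I \<Longrightarrow> z \<in> convex hull (l ` S i)"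
  shows "z \<in> Lambda (card I) U"
proof -
  have "\<exists>u. (\<forall>m\<in>S j. 0 \<le> u m) \<and> sum u (S j) = 1 \<and> (\<Sum>m\<in>S j. of_real (u m) * l m) = z"
    if j: "j \<in> I" for j
  proof -
    obtain w where w: "\<forall>x\<in>l ` S j. 0 \<le> w x" "sum w (l ` S j) = 1" "(\<Sum>x\<in>l ` S j. w x *\<^sub>R x) = z"
      using assms(6)[OF j] unfolding convex_hull_finite[OF finite_imageI[OF finite]] by blast
    have inj: "inj_on l (S j)" using assms(3) by (rule inj_on_subset) simp
    show ?thesis
      using w by (intro exI[of _ "\<lambda>m. w (l m)"]) (auto simp: sum.reindex[OF inj] scaleR_conv_of_real)
  qed
  then obtain u where u: "\<And>j. j \<in> I \<Longrightarrow>
      (\<forall>m\<in>S j. 0 \<le> u j m) \<and> sum (u j) (S j) = 1 \<and> (\<Sum>m\<in>S j. of_real (u j m) * l m) = z"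
    by metis
  define \<phi> where "\<phi> j = (\<Sum>m\<in>S j. of_real (sqrt (u j m)) *s \<psi> m)" for j
  have on: "orthonormal_on I \<phi>"
    and compr: "\<And>i j. i \<in> I \<Longrightarrow> j \<in> I \<Longrightarrow> cinner (\<phi> i) (U *v \<phi> j) = (if i = j then z else 0)"
    using sqrt_combinations[OF assms(1,2,5), of u z \<phi>] u by (auto simp: \<phi>_def)
  have P: "orth_proj (frame_proj I \<phi>)" by (rule orth_proj_frame_proj[OF on assms(4)])
  moreover have "rank (frame_proj I \<phi>) = card I"
    using rank_orth_proj[OF P] range_frame_proj[OF on assms(4)] dim_span_orthonormal[OF on assms(4)]
    by simp
  ultimately show ?thesis
    using frame_proj_compression[OF assms(4) compr] unfolding Lambda_def by blast
qed

section \<open>Unitary operators: disjoint triangles and the final assembly\<close>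

lemma norm_eigenvalue_of_unitary:
  assumes "unitary U" "U *v x = c *s x" "x \<noteq> 0"
  shows "norm c = 1"
proof -
  have "cinner x x = cinner (U *v x) (U *v x)"
    using assms(1) by (simp add: cinner_adj matrix_vector_mul_assoc unitary_def)
  also have "\<dots> = c * cnj c * cinner x x"
    by (simp add: assms(2) cinner_scale_left cinner_scale_right)
  finally have "c * cnj c * cinner x x = cinner x x" by simp
  then have "complex_of_real ((norm c)\<^sup>2) = 1"
    using assms(3) unfolding complex_norm_square by (simp add: cinner_self)
  then have "(norm c)\<^sup>2 = 1" by (metis of_real_eq_1_iff)
  then show ?thesis by (simp add: power2_eq_1_iff abs_if) (smt (verit) norm_ge_zero)
qed

text \<open>Splits the one condition on all \<open>3 * k\<close> indices into distinctness within a
  triple, for sums over it, and disjointness of the triples, for orthogonality and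
  \<open>Delta\<close>.\<close>

lemma distinct_triples:
  assumes "distinct (map a [1..<k+1] @ map b [1..<k+1] @ map c [1..<k+1])"
  shows "\<And>j. j \<in> {1..k} \<Longrightarrow> a j \<noteq> b j \<and> a j \<noteq> c j \<and> b j \<noteq> c j"
    and "disjoint_family_on (\<lambda>j. {a j, b j, c j}) {1..k}"
proof -
  have "set [1..<k+1] = {1..k}" by auto
  then have inj: "inj_on a {1..k}" "inj_on b {1..k}" "inj_on c {1..k}"
    and dis: "a ` {1..k} \<inter> b ` {1..k} = {}" "a ` {1..k} \<inter> c ` {1..k} = {}" "b ` {1..k} \<inter> c ` {1..k} = {}"
    using assms by (auto simp: distinct_map)
  show "a j \<noteq> b j \<and> a j \<noteq> c j \<and> b j \<noteq> c j" if "j \<in> {1..k}" for j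
    using dis that by blast
  show "disjoint_family_on (\<lambda>j. {a j, b j, c j}) {1..k}"
    unfolding disjoint_family_on_def
  proof (intro ballI impI)
    fix i j assume ij: "i \<in> {1..k}" "j \<in> {1..k}" "i \<noteq> j"
    then have "a i \<noteq> a j" "b i \<noteq> b j" "c i \<noteq> c j"
      using inj by (auto dest: inj_onD)
    moreover have "a i \<noteq> b j" "a i \<noteq> c j" "b i \<noteq> a j" "b i \<noteq> c j" "c i \<noteq> a j" "c i \<noteq> b j"
      using dis ij by blast+
    ultimately show "{a i, b i, c i} \<inter> {a j, b j, c j} = {}" by simp
  qed
qed

lemma exists_disjoint_triangles:
  fixes l :: "'n::finite \<Rightarrow> complex"
  assumes "inj l" "\<And>i. norm (l i) = 1" "3 * k \<le> CARD('n)"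
    and "\<And>S :: 'n set. card S = CARD('n) - k + 1 \<Longrightarrow> z \<in> convex hull (l ` S)"
  shows "\<exists>a b c :: nat \<Rightarrow> 'n.
      distinct (map a [1..<k+1] @ map b [1..<k+1] @ map c [1..<k+1]) \<and>
      (\<forall>j\<in>{1..k}. z \<in> convex hull {l (a j), l (b j), l (c j)})"
proof -
  have "depth_at_least k UNIV (\<lambda>i. l i - z)"
    using assms(3,4) by (intro depth_at_least_of_mem_hulls) auto
  then obtain e where e: "inj_on e {..<3 * k}"
    "\<And>j. j < k \<Longrightarrow> z \<in> convex hull {l (e j), l (e (k + j)), l (e (2 * k + j))}"
    using exists_triangles_of_depth[of UNIV k l z] assms(1-3) by auto
  \<comment> \<open>Triples are numbered from 1 and \<open>e\<close> from 0. The three lists below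
    are consecutive blocks of length \<open>k\<close> of the enumeration.\<close>
  define a b c where "a j = e (j - 1)" and "b j = e (k + (j - 1))" and "c j = e (2 * k + (j - 1))" for j
  have "map a [1..<k+1] = map e [0..<k]" "map b [1..<k+1] = map e [k..<2*k]"
    "map c [1..<k+1] = map e [2*k..<3*k]"
    by (auto simp: a_def b_def c_def list_eq_iff_nth_eq simp del: upt_Suc)
  then have "map a [1..<k+1] @ map b [1..<k+1] @ map c [1..<k+1] = map e ([0..<k] @ [k..<2*k] @ [2*k..<3*k])"
    by simp
  moreover have "distinct \<dots>"
    unfolding distinct_map using e(1) by (auto intro: inj_on_subset)
  ultimately have "distinct (map a [1..<k+1] @ map b [1..<k+1] @ map c [1..<k+1])" by simp
  moreover have "z \<in> convex hull {l (a j), l (b j), l (c j)}" if "j \<in> {1..k}" for j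
    using e(2)[of "j - 1"] that by (auto simp: a_def b_def c_def)
  ultimately show ?thesis by blast
qed

theorem mainTheorem7:
  fixes U :: "complex ^ 'n ^ 'n" and lam :: "'n \<Rightarrow> complex" and \<psi> :: "'n \<Rightarrow> complex ^ 'n"
    and k :: nat
  assumes "unitary U"
    and "inj lam"
    and "orthonormal_on UNIV \<psi>"
    and "\<forall>i. U *v \<psi> i = lam i *s \<psi> i"
    and "k \<ge> 1"
    and "CARD('n) \<ge> 3 * k"
  shows "Delta k U = Lambda k U \<and> Lambda k U = Omega k U \<and> Omega k U \<noteq> {} \<and>
    (\<forall>z\<in>Omega k U.
      (\<exists>a b c :: nat \<Rightarrow> 'n.
        distinct (map a [1..<k+1] @ map b [1..<k+1] @ map c [1..<k+1]) \<and>
        (\<forall>j\<in>{1..k}. z \<in> convex hull {lam (a j), lam (b j), lam (c j)})) \<and>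
      (\<forall>(a :: nat \<Rightarrow> 'n) (b :: nat \<Rightarrow> 'n) (c :: nat \<Rightarrow> 'n)
        (t1 :: nat \<Rightarrow> real) (t2 :: nat \<Rightarrow> real) (t3 :: nat \<Rightarrow> real).
        distinct (map a [1..<k+1] @ map b [1..<k+1] @ map c [1..<k+1]) \<longrightarrow>
        (\<forall>j\<in>{1..k}. t1 j \<ge> 0 \<and> t2 j \<ge> 0 \<and> t3 j \<ge> 0 \<and> t1 j + t2 j + t3 j = 1 \<and>
           z = of_real (t1 j) * lam (a j) + of_real (t2 j) * lam (b j)
               + of_real (t3 j) * lam (c j)) \<longrightarrow>
        (let \<phi> = (\<lambda>j. of_real (sqrt (t1 j)) *s \<psi> (a j) + of_real (sqrt (t2 j)) *s \<psi> (b j)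
                      + of_real (sqrt (t3 j)) *s \<psi> (c j));
             C = vec.span (\<phi> ` {1..k})
         in orthonormal_on {1..k} \<phi> \<and> vec.dim C = k \<and>
            (\<forall>p :: real. 0 < p \<and> p < 1 \<longrightarrow>
              (let \<E> = (\<lambda>\<rho>. cscale (of_real p) \<rho> + cscale (of_real (1 - p)) (U ** \<rho> ** adj U))
               in quantum_operation \<E> \<and> correctable \<E> C)))))"
proof -
  have eig: "U *v \<psi> i = lam i *s \<psi> i" for i using assms(4) by blast
  have "\<psi> i \<noteq> 0" for i
    using orthonormal_onD[OF assms(3), of i i] by auto
  then have lam1: "norm (lam i) = 1" for i
    using norm_eigenvalue_of_unitary[OF assms(1) eig] by blast
  have listing: "eigenvalue_listing U lam"
    using eigenvalue_listing_of_eigenbasis[OF assms(3) eig] .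
  \<comment> \<open>From here both sets are expressed through \<open>lam\<close> instead of the
    listing chosen by \<open>eigenvalues\<close>.\<close>
  note Omega = Omega_eq[OF listing, of k] and Delta = Delta_eq[OF listing, of k]
  have tri: "\<exists>a b c :: nat \<Rightarrow> 'n.
        distinct (map a [1..<k+1] @ map b [1..<k+1] @ map c [1..<k+1]) \<and>
        (\<forall>j\<in>{1..k}. z \<in> convex hull {lam (a j), lam (b j), lam (c j)})"
    if "z \<in> Omega k U" for z
    using that unfolding Omega
    by (intro exists_disjoint_triangles[OF assms(2) lam1 assms(6)]) blast
  have DL: "Delta k U \<subseteq> Lambda k U"
  proof
    fix z assume "z \<in> Delta k U"
    then obtain S :: "nat \<Rightarrow> 'n set" where "disjoint_family_on S {1..k}"
      "\<And>i. i \<in> {1..k} \<Longrightarrow> z \<in> convex hull (lam ` S i)"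
      unfolding Delta by blast
    then show "z \<in> Lambda k U"
      using mem_Lambda_of_disjoint_hulls[OF assms(3) eig assms(2), of "{1..k}" S z] by simp
  qed
  have LO: "Lambda k U \<subseteq> Omega k U"
    unfolding Omega using mem_convex_hull_of_mem_Lambda[OF assms(3) eig] by blast
  have OD: "Omega k U \<subseteq> Delta k U"
  proof
    fix z assume "z \<in> Omega k U"
    then obtain a b c :: "nat \<Rightarrow> 'n"
      where d: "distinct (map a [1..<k+1] @ map b [1..<k+1] @ map c [1..<k+1])"
        and z: "\<forall>j\<in>{1..k}. z \<in> convex hull {lam (a j), lam (b j), lam (c j)}"
      using tri by blast
    show "z \<in> Delta k U"
      unfolding Delta
      using distinct_triples(2)[OF d] z by (intro CollectI exI[of _ "\<lambda>j. {a j, b j, c j}"]) simp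
  qed
  have ne: "Omega k U \<noteq> {}"
    unfolding Omega using assms(5,6) by (rule hulls_meet)
  have code: "let \<phi> = (\<lambda>j. of_real (sqrt (t1 j)) *s \<psi> (a j) + of_real (sqrt (t2 j)) *s \<psi> (b j)
                      + of_real (sqrt (t3 j)) *s \<psi> (c j));
             C = vec.span (\<phi> ` {1..k})
         in orthonormal_on {1..k} \<phi> \<and> vec.dim C = k \<and>
            (\<forall>p :: real. 0 < p \<and> p < 1 \<longrightarrow>
              (let \<E> = (\<lambda>\<rho>. cscale (of_real p) \<rho> + cscale (of_real (1 - p)) (U ** \<rho> ** adj U))
               in quantum_operation \<E> \<and> correctable \<E> C))"
    if d: "distinct (map a [1..<k+1] @ map b [1..<k+1] @ map c [1..<k+1])"
      and t: "\<forall>j\<in>{1..k}. t1 j \<ge> 0 \<and> t2 j \<ge> 0 \<and> t3 j \<ge> 0 \<and> t1 j + t2 j + t3 j = 1 \<and>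
           z = of_real (t1 j) * lam (a j) + of_real (t2 j) * lam (b j)
               + of_real (t3 j) * lam (c j)"
    for z and a b c :: "nat \<Rightarrow> 'n" and t1 t2 t3 :: "nat \<Rightarrow> real"
  proof -
    define \<phi> where "\<phi> = (\<lambda>j. of_real (sqrt (t1 j)) *s \<psi> (a j) + of_real (sqrt (t2 j)) *s \<psi> (b j)
                      + of_real (sqrt (t3 j)) *s \<psi> (c j))"
    \<comment> \<open>\<open>sqrt_combinations\<close> takes weights as a function of the eigenvalue
      index; distinctness within the triple makes the nested conditional return the right
      one.\<close>
    define u where "u j m = (if m = a j then t1 j else if m = b j then t2 j else t3 j)" for j m
    note ne = distinct_triples(1)[OF d]
    \<comment> \<open>\<open>f\<close> is generic so that one identity yields the total weight, the
      value \<open>z\<close> and the vector \<open>\<phi> j\<close>.\<close>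
    have sum3: "(\<Sum>m\<in>{a j, b j, c j}. f (u j m) m) = f (t1 j) (a j) + f (t2 j) (b j) + f (t3 j) (c j)"
      if "j \<in> {1..k}" for f :: "real \<Rightarrow> 'n \<Rightarrow> 'x::comm_monoid_add" and j
      using ne[OF that] by (auto simp: u_def add.assoc)
    have on: "orthonormal_on {1..k} \<phi>"
      and compr: "\<And>i j. i \<in> {1..k} \<Longrightarrow> j \<in> {1..k} \<Longrightarrow>
          cinner (\<phi> i) (U *v \<phi> j) = (if i = j then z else 0)"
    proof (atomize (full), intro conjI)
      have u: "0 \<le> u j m" if "j \<in> {1..k}" for j m using t that by (simp add: u_def)
      have u1: "(\<Sum>m\<in>{a j, b j, c j}. u j m) = 1" if "j \<in> {1..k}" for j
        using sum3[OF that, of "\<lambda>x _. x"] t that by simp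
      have uz: "(\<Sum>m\<in>{a j, b j, c j}. of_real (u j m) * lam m) = z" if "j \<in> {1..k}" for j
        using sum3[OF that, of "\<lambda>x m. of_real x * lam m"] t that by simp
      have ph: "\<phi> j = (\<Sum>m\<in>{a j, b j, c j}. of_real (sqrt (u j m)) *s \<psi> m)" if "j \<in> {1..k}" for j
        using sum3[OF that, of "\<lambda>x m. of_real (sqrt x) *s \<psi> m"] by (simp add: \<phi>_def)
      note comb = sqrt_combinations[OF assms(3) eig distinct_triples(2)[OF d] u u1 uz ph]
      show "orthonormal_on {1..k} \<phi>" by (rule comb(1))
      show "\<forall>i j. i \<in> {1..k} \<longrightarrow> j \<in> {1..k} \<longrightarrow>
          cinner (\<phi> i) (U *v \<phi> j) = (if i = j then z else 0)"
        using comb(2) by blast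
    qed
    have C: "range ((*v) (frame_proj {1..k} \<phi>)) = vec.span (\<phi> ` {1..k})"
      using on by (rule range_frame_proj) simp
    have "correctable (mixed_unitary p U) (vec.span (\<phi> ` {1..k}))" for p
      using correctable_of_compression[OF assms(1) orth_proj_frame_proj[OF on]
          frame_proj_compression[OF _ compr]] C by simp
    moreover have "mixed_unitary p U
        = (\<lambda>\<rho>. cscale (of_real p) \<rho> + cscale (of_real (1 - p)) (U ** \<rho> ** adj U))" for p
      by (simp add: fun_eq_iff mixed_unitary_def)
    moreover have "vec.dim (vec.span (\<phi> ` {1..k})) = k"
      using dim_span_orthonormal[OF on] by simp
    ultimately show ?thesis
      using on quantum_operation_mixed_unitary[OF assms(1)]
      unfolding Let_def \<phi>_def[symmetric] by (metis less_imp_le)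
  qed
  show ?thesis
    using DL LO OD ne tri code by (intro conjI ballI allI impI) (blast | simp)+
qed

end
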